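(* Fix $(t,B,L,d)$ and consider the model with parameters $(\beta,\mu)$, $\beta,\mu>0$. Let $\mu_{Lar}(\infty;t)$ be the unique $\mu>0$ with $4B''(0)R_2(\mu;t)=1$. Then: (i) if $\mu<\mu_{Lar}(\infty;t)$, the model with parameters $(\beta,\mu)$ is RSB for all sufficiently large $\beta$; (ii) if $\mu\ge\mu_{Lar}(\infty;t)$, the model with parameters $(\beta,\mu)$ is RS for all $\beta$.
   Context: $L\ge1$, $d\ge0$ are integers and $t>0$. $\Omega=[[1,L]]^d$ is regarded as a graph with periodic boundary conditions (discrete torus), $|\Omega|=L^d$, and $\Delta$ is its graph Laplacian with the sign convention that $\Delta$ is negative semi-definite. For $A\in\mathbb R^{\Omega\times\Omega}$, $\mathrm{tr}(A)=|\Omega|^{-1}\sum_{x\in\Omega}A_{xx}$. $B(x)=\int_0^\infty e^{-\lambda^2x}\nu(d\lambda)$ for a finite non-negative, non-zero measure $\nu$ on $(0,\infty)$ with $\int_0^\infty e^{\epsilon\lambda^2}\nu(d\lambda)<\infty$ for some $\epsilon>0$ (so $B$ is smooth on $(-\epsilon,\infty)$). For $i\ge1$, $R_i(u;t)=\mathrm{tr}(uI-t\Delta)^{-i}$, $u>0$; $K(\cdot;t):(0,\infty)\to(0,\infty)$ is the functional inverse of $R_1(\cdot;t)$, and $K'$ is its derivative in the first argument. $\mathscr{Y}(q)$ is the set of probability measures on $[0,q]$ whose support does not contain $q$. For given $(\beta,\mu)$, the pair $(q_c,\zeta_c)$ is the unique pair $(q,\zeta)$ with $q\in(0,\infty)$,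 $\zeta\in\mathscr{Y}(q)$ such that, with $\delta(s)=\int_s^q\zeta([0,u])du$, $F_{\beta,q}(s)=-2B'(2(q-s))+\int_0^sK'(\beta\delta(u);t)du$ and $f_{\beta,q}(s)=\int_0^sF_{\beta,q}(u)du$ for $s\in(0,q)$ (extended to $[0,q]$ by its limits $f_{\beta,q}(0)=0$, $f_{\beta,q}(q)=-\infty$), $$\beta\int_0^q\zeta([0,u])du=R_1(\mu;t),\qquad \zeta\Big(\big\{s\in[0,q]:f_{\beta,q}(s)=\sup_{0<s'<q}f_{\beta,q}(s')\big\}\Big)=1.$$ ($\zeta_c$ is the Parisi measure of the elastic manifold model at inverse temperature $\beta$ and mass $\mu$.) The model is replica symmetric (RS) if $\zeta_c$ is a Dirac mass, and replica symmetry breaking (RSB) if the support of $\zeta_c$ contains more than one point. *)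

theory Defs
  imports "HOL-Probability.Probability" "Jordan_Normal_Form.Gauss_Jordan_Elimination"
begin

section \<open>The discrete torus and its Laplacian\<close>

definition torus :: "nat \<Rightarrow> nat \<Rightarrow> (nat \<Rightarrow> nat) set" where
  "torus L d = PiE {..<d} (\<lambda>_. {1..L})"

text \<open>The torus is a simple graph: for \<open>L = 1\<close> there are no edges, and for \<open>L = 2\<close> the two
  neighbours in a given direction coincide and are joined by a single edge.\<close>

definition torus_adj :: "nat \<Rightarrow> nat \<Rightarrow> (nat \<Rightarrow> nat) \<Rightarrow> (nat \<Rightarrow> nat) \<Rightarrow> bool" where
  "torus_adj L d x y \<longleftrightarrow> x \<in> torus L d \<and> y \<in> torus L d \<and> x \<noteq> y \<and>
     (\<exists>j<d. (Suc (x j) mod L = y j mod L \<or> Suc (y j) mod L = x j mod L) \<and>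
            (\<forall>i<d. i \<noteq> j \<longrightarrow> x i = y i))"

definition torus_laplacian :: "nat \<Rightarrow> nat \<Rightarrow> (nat \<Rightarrow> nat) \<Rightarrow> (nat \<Rightarrow> nat) \<Rightarrow> real" where
  "torus_laplacian L d x y =
     (if x = y then - real (card {z. torus_adj L d x z})
      else if torus_adj L d x y then 1 else 0)"

text \<open>Matrices are indexed by \<open>{..<L ^ d}\<close>; the sites of the torus are enumerated by the base
  \<open>L\<close> digits of the index.\<close>

definition site :: "nat \<Rightarrow> nat \<Rightarrow> nat \<Rightarrow> nat \<Rightarrow> nat" where
  "site L d k = (\<lambda>j\<in>{..<d}. Suc (k div L ^ j mod L))"

lemma digits_inj:
  fixes k l :: nat
  assumes "k < L ^ d" "l < L ^ d" "\<And>j. j < d \<Longrightarrow> k div L ^ j mod L = l div L ^ j mod L"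
  shows "k = l"
  using assms
proof (induction d arbitrary: k l)
  case (Suc d)
  have "k mod L = l mod L"
    using Suc.prems(3)[of 0] by simp
  moreover have "k div L = l div L"
  proof (rule Suc.IH)
    show "k div L < L ^ d" "l div L < L ^ d"
      using Suc.prems(1,2) by (simp_all add: less_mult_imp_div_less mult.commute)
    fix j assume "j < d"
    then show "k div L div L ^ j mod L = l div L div L ^ j mod L"
      using Suc.prems(3)[of "Suc j"] by (simp add: div_mult2_eq)
  qed
  ultimately show ?case
    by (metis div_mult_mod_eq)
qed simp

lemma bij_betw_site:
  assumes "1 \<le> L"
  shows "bij_betw (site L d) {..<L ^ d} (torus L d)"
proof -
  have inj: "inj_on (site L d) {..<L ^ d}"
  proof (rule inj_onI)
    fix k l assume kl: "k \<in> {..<L ^ d}" "l \<in> {..<L ^ d}" "site L d k = site L d l"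
    have "k div L ^ j mod L = l div L ^ j mod L" if "j < d" for j
      using fun_cong[OF kl(3), of j] that by (simp add: site_def)
    with kl show "k = l" by (intro digits_inj[of k L d l]) auto
  qed
  have sub: "site L d ` {..<L ^ d} \<subseteq> torus L d"
    using assms by (auto simp: site_def torus_def Suc_le_eq split: if_splits)
  have "card (torus L d) = L ^ d"
    by (simp add: torus_def card_PiE)
  moreover have "finite (torus L d)"
    by (auto simp: torus_def intro: finite_PiE)
  ultimately have "site L d ` {..<L ^ d} = torus L d"
    using sub inj by (metis card_image card_lessThan card_subset_eq)
  with inj show ?thesis
    by (simp add: bij_betw_def)
qed

definition laplacian_mat :: "nat \<Rightarrow> nat \<Rightarrow> real mat" where
  "laplacian_mat L d = mat (L ^ d) (L ^ d) (\<lambda>(k, l). torus_laplacian L d (site L d k) (site L d l))"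

section \<open>Traces of resolvents\<close>

definition normalized_trace :: "real mat \<Rightarrow> real" where
  "normalized_trace A = (\<Sum>k<dim_row A. A $$ (k, k)) / real (dim_row A)"

text \<open>\<open>resolvent_trace L d t i u\<close> is \<open>R\<^sub>i(u; t)\<close>; the matrix is invertible for \<open>u > 0\<close>.\<close>

definition resolvent_trace :: "nat \<Rightarrow> nat \<Rightarrow> real \<Rightarrow> nat \<Rightarrow> real \<Rightarrow> real" where
  "resolvent_trace L d t i u = normalized_trace
     (the (mat_inverse (u \<cdot>\<^sub>m 1\<^sub>m (L ^ d) - t \<cdot>\<^sub>m laplacian_mat L d)) ^\<^sub>m i)"

definition K_fun :: "nat \<Rightarrow> nat \<Rightarrow> real \<Rightarrow> real \<Rightarrow> real" where
  "K_fun L d t = the_inv_into {0<..} (resolvent_trace L d t 1)"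

section \<open>The correlation function\<close>

definition correlation_measure :: "real measure \<Rightarrow> bool" where
  "correlation_measure \<nu> \<longleftrightarrow>
     sets \<nu> = sets (restrict_space borel {0<..}) \<and> finite_measure \<nu> \<and> emeasure \<nu> (space \<nu>) \<noteq> 0 \<and>
     (\<exists>\<epsilon>>0. (\<integral>\<^sup>+ l. ennreal (exp (\<epsilon> * l\<^sup>2)) \<partial>\<nu>) < \<infinity>)"

definition B_fun :: "real measure \<Rightarrow> real \<Rightarrow> real" where
  "B_fun \<nu> x = (\<integral> l. exp (- (l\<^sup>2 * x)) \<partial>\<nu>)"

definition larkin_mass :: "real measure \<Rightarrow> nat \<Rightarrow> nat \<Rightarrow> real \<Rightarrow> real" where
  "larkin_mass \<nu> L d t =
     (THE \<mu>. 0 < \<mu> \<and> 4 * deriv (deriv (B_fun \<nu>)) 0 * resolvent_trace L d t 2 \<mu> = 1)"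

section \<open>The Parisi measure\<close>

definition measure_support :: "'a::topological_space measure \<Rightarrow> 'a set" where
  "measure_support M =
     {x \<in> space M. \<forall>U. open U \<longrightarrow> x \<in> U \<longrightarrow> emeasure M (U \<inter> space M) \<noteq> 0}"

definition Y_space :: "real \<Rightarrow> real measure set" where
  "Y_space q = {\<zeta>. sets \<zeta> = sets (restrict_space borel {0..q}) \<and> prob_space \<zeta> \<and>
     q \<notin> measure_support \<zeta>}"

definition delta_fun :: "real \<Rightarrow> real measure \<Rightarrow> real \<Rightarrow> real" where
  "delta_fun q \<zeta> s = integral {s..q} (\<lambda>u. measure \<zeta> {0..u})"

definition F_fun ::
  "real measure \<Rightarrow> nat \<Rightarrow> nat \<Rightarrow> real \<Rightarrow> real \<Rightarrow> real \<Rightarrow> real measure \<Rightarrow> real \<Rightarrow> real" where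
  "F_fun \<nu> L d t \<beta> q \<zeta> s =
     - 2 * deriv (B_fun \<nu>) (2 * (q - s)) +
     integral {0..s} (\<lambda>u. deriv (K_fun L d t) (\<beta> * delta_fun q \<zeta> u))"

definition f_fun ::
  "real measure \<Rightarrow> nat \<Rightarrow> nat \<Rightarrow> real \<Rightarrow> real \<Rightarrow> real \<Rightarrow> real measure \<Rightarrow> real \<Rightarrow> ereal" where
  "f_fun \<nu> L d t \<beta> q \<zeta> s =
     (if s = q then - \<infinity> else ereal (integral {0..s} (F_fun \<nu> L d t \<beta> q \<zeta>)))"

text \<open>\<open>parisi_pair \<nu> L d t \<beta> \<mu> q \<zeta>\<close> is the system of conditions that determines the pair
  \<open>(q\<^sub>c, \<zeta>\<^sub>c)\<close> uniquely; its solution \<open>\<zeta>\<close> is the Parisi measure.\<close>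

definition parisi_pair ::
  "real measure \<Rightarrow> nat \<Rightarrow> nat \<Rightarrow> real \<Rightarrow> real \<Rightarrow> real \<Rightarrow> real \<Rightarrow> real measure \<Rightarrow> bool" where
  "parisi_pair \<nu> L d t \<beta> \<mu> q \<zeta> \<longleftrightarrow>
     0 < q \<and> \<zeta> \<in> Y_space q \<and>
     \<beta> * integral {0..q} (\<lambda>u. measure \<zeta> {0..u}) = resolvent_trace L d t 1 \<mu> \<and>
     measure \<zeta> {s \<in> {0..q}. f_fun \<nu> L d t \<beta> q \<zeta> s =
                             (SUP s'\<in>{0<..<q}. f_fun \<nu> L d t \<beta> q \<zeta> s')} = 1"

definition replica_symmetric :: "real measure \<Rightarrow> bool" where
  "replica_symmetric \<zeta> \<longleftrightarrow> (\<exists>s\<in>space \<zeta>. \<zeta> = return \<zeta> s)"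

definition replica_symmetry_breaking :: "real measure \<Rightarrow> bool" where
  "replica_symmetry_breaking \<zeta> \<longleftrightarrow>
     (\<exists>x\<in>measure_support \<zeta>. \<exists>y\<in>measure_support \<zeta>. x \<noteq> y)"

end

theory Submission
  imports Defs "Jordan_Normal_Form.Schur_Decomposition"
begin

text \<open>A maximiser \<open>s\<close> of \<open>f\<close> lies in \<open>(0, q)\<close> and satisfies \<open>F(s) = 0\<close> and \<open>F'(s) \<le> 0\<close>, where
  \<open>F'(s) = 4 B''(2 (q - s)) + K'(\<beta> \<delta>(s))\<close>. Differentiating \<open>K(R\<^sub>1(u)) = u\<close> gives
  \<open>K'(R\<^sub>1(u)) = -1 / R\<^sub>2(u)\<close>, and \<open>\<beta> \<delta>(s) \<le> R\<^sub>1(\<mu>)\<close> gives \<open>K'(\<beta> \<delta>(s)) \<le> -1 / R\<^sub>2(\<mu>)\<close>.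
  If \<open>\<mu>\<close> is at least the Larkin mass, then \<open>4 B''(x) < 4 B''(0) \<le> 1 / R\<^sub>2(\<mu>)\<close> for \<open>x > 0\<close>, so \<open>F\<close> is
  strictly decreasing, has only one zero, and the Parisi measure is a Dirac mass there.
  Conversely, for a Dirac mass at \<open>x\<close> one has \<open>\<beta> (q - x) = R\<^sub>1(\<mu>)\<close>, and \<open>F'(x) \<le> 0\<close> becomes
  \<open>4 B''(2 R\<^sub>1(\<mu>) / \<beta>) R\<^sub>2(\<mu>) \<le> 1\<close>; letting \<open>\<beta>\<close> tend to infinity, this fails below the Larkin mass.\<close>

unbundle no vec_syntax

section \<open>Traces of powers of a resolvent\<close>

text \<open>Over the complex numbers the characteristic polynomial splits. For an eigenvector
  \<open>v\<close> to the eigenvalue \<open>a\<close>, the Hermitian form \<open>S\<close> of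
  \<open>A\<close> at \<open>v\<close> equals \<open>a * N\<close>, where \<open>N\<close> is the
  squared norm of \<open>v\<close>. Swapping the two summations and using symmetry shows that
  \<open>S\<close> is real, hence so is \<open>a\<close>. Injectivity of the embedding of the reals
  then pulls the factorization back.\<close>

lemma symmetric_mat_char_poly_splits:
  fixes A :: "real mat"
  assumes A: "A \<in> carrier_mat n n"
    and sym: "\<And>i j. i < n \<Longrightarrow> j < n \<Longrightarrow> A $$ (i, j) = A $$ (j, i)"
  obtains es where "char_poly A = (\<Prod>e\<leftarrow>es. [:- e, 1:])" "length es = n"
proof -
  let ?C = "map_mat complex_of_real A"
  have C: "?C \<in> carrier_mat n n"
    using A by simp
  obtain as where as: "char_poly ?C = (\<Prod>a\<leftarrow>as. [:- a, 1:])" "length as = n"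
    using char_poly_factorized[OF C] by auto
  have real: "complex_of_real (Re a) = a" if a: "a \<in> set as" for a
  proof -
    have "poly (char_poly ?C) a = 0"
      using a by (auto simp: as(1) poly_prod_list prod_list_zero_iff)
    then obtain v where v: "v \<in> carrier_vec n" "v \<noteq> 0\<^sub>v n" "?C *\<^sub>v v = a \<cdot>\<^sub>v v"
      using eigenvalue_root_char_poly[OF C] A unfolding eigenvalue_def eigenvector_def by auto
    define N where "N = (\<Sum>i<n. cnj (v $ i) * v $ i)"
    define S where "S = (\<Sum>i<n. \<Sum>j<n. cnj (v $ i) * complex_of_real (A $$ (i, j)) * v $ j)"
    have row: "(\<Sum>j<n. complex_of_real (A $$ (i, j)) * v $ j) = a * v $ i" if "i < n" for i
    proof -
      have "(?C *\<^sub>v v) $ i = (\<Sum>j<n. complex_of_real (A $$ (i, j)) * v $ j)"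
        using that A v(1) by (simp add: scalar_prod_def atLeast0LessThan)
      then show ?thesis
        using v(1) v(3) that by simp
    qed
    have "S = (\<Sum>i<n. cnj (v $ i) * (\<Sum>j<n. complex_of_real (A $$ (i, j)) * v $ j))"
      by (simp add: S_def sum_distrib_left mult.assoc)
    also have "\<dots> = (\<Sum>i<n. cnj (v $ i) * (a * v $ i))"
      by (intro sum.cong) (auto simp: row)
    also have "\<dots> = a * N"
      by (simp add: N_def sum_distrib_left mult_ac)
    finally have S: "S = a * N" .
    have "cnj S = (\<Sum>i<n. \<Sum>j<n. v $ i * complex_of_real (A $$ (i, j)) * cnj (v $ j))"
      by (simp add: S_def)
    also have "\<dots> = (\<Sum>j<n. \<Sum>i<n. v $ i * complex_of_real (A $$ (i, j)) * cnj (v $ j))"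
      by (rule sum.swap)
    also have "\<dots> = S"
      unfolding S_def by (intro sum.cong) (auto simp: sym mult_ac)
    finally have "cnj S = S" .
    moreover have N: "N = complex_of_real (\<Sum>i<n. (cmod (v $ i))\<^sup>2)"
      by (simp add: N_def complex_norm_square mult.commute del: of_real_power)
    ultimately have "cnj a * N = a * N"
      by (simp add: S)
    moreover have "N \<noteq> 0"
    proof
      assume "N = 0"
      then have "(\<Sum>i<n. (cmod (v $ i))\<^sup>2) = 0"
        unfolding N of_real_eq_0_iff .
      then have "\<forall>i<n. v $ i = 0"
        by (subst (asm) sum_nonneg_eq_0_iff) auto
      then have "v = 0\<^sub>v n"
        using v(1) by (intro eq_vecI) auto
      then show False
        using v(2) by simp
    qed
    ultimately have "cnj a = a"
      by simp
    then show ?thesis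
      by (metis Reals_cnj_iff of_real_Re)
  qed
  interpret H: map_poly_inj_idom_hom complex_of_real ..
  have "map_poly complex_of_real (char_poly A) = char_poly ?C"
    by (rule of_real_hom.char_poly_hom[OF A, symmetric])
  also have "\<dots> = (\<Prod>a\<leftarrow>as. map_poly complex_of_real [:- Re a, 1:])"
    unfolding as(1) using real by (intro arg_cong[of _ _ prod_list] map_cong) auto
  also have "\<dots> = map_poly complex_of_real (\<Prod>e\<leftarrow>map Re as. [:- e, 1:])"
    by (simp add: H.hom_prod_list o_def)
  finally have "char_poly A = (\<Prod>e\<leftarrow>map Re as. [:- e, 1:])"
    by (simp only: H.eq_iff)
  then show thesis
    using that as(2) by (metis length_map)
qed

section \<open>Inverses and powers of upper triangular matrices\<close>

lemma upper_triangular_inverse: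
  fixes U D :: "'a :: field mat"
  assumes U: "U \<in> carrier_mat n n" "upper_triangular U"
    and D: "D \<in> carrier_mat n n" "D * U = 1\<^sub>m n"
    and diag: "\<And>i. i < n \<Longrightarrow> U $$ (i, i) \<noteq> 0"
  shows "upper_triangular D" "\<And>i. i < n \<Longrightarrow> D $$ (i, i) = inverse (U $$ (i, i))"
proof -
  have entry: "(\<Sum>l<n. D $$ (i, l) * U $$ (l, j)) = (if i = j then 1 else 0)"
    if "i < n" "j < n" for i j
  proof -
    have "(D * U) $$ (i, j) = (\<Sum>l<n. D $$ (i, l) * U $$ (l, j))"
      using U D(1) that by (simp add: scalar_prod_def atLeast0LessThan)
    then show ?thesis
      unfolding D(2) using that by simp
  qed
  \<comment> \<open>Terms with \<open>l > j\<close> vanish because \<open>U\<close> is upper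
    triangular, terms with \<open>l < j\<close> by the assumption on row \<open>i\<close> of
    \<open>D\<close>.\<close>
  have trunc: "(\<Sum>l<n. D $$ (i, l) * U $$ (l, j)) = D $$ (i, j) * U $$ (j, j)"
    if "j < n" "\<And>l. l < j \<Longrightarrow> D $$ (i, l) = 0" for i j
  proof -
    have "(\<Sum>l<n. D $$ (i, l) * U $$ (l, j)) = (\<Sum>l\<in>{j}. D $$ (i, l) * U $$ (l, j))"
      using that U by (intro sum.mono_neutral_right) (auto, metis linorder_neqE_nat upper_triangularD carrier_matD(1))
    then show ?thesis
      by simp
  qed
  \<comment> \<open>Row \<open>i\<close> is cleared from left to right: once the entries before
    column \<open>j\<close> vanish, entry \<open>(i, j)\<close> of \<open>D * U = 1\<close> is a
    single product with a nonzero diagonal entry of \<open>U\<close>.\<close>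
  have zero: "D $$ (i, j) = 0" if "j < i" "i < n" for i j
    using that
  proof (induction j rule: less_induct)
    case (less j)
    then have "D $$ (i, j) * U $$ (j, j) = 0"
      using trunc[of j i] entry[of i j] by auto
    then show ?case
      using diag[of j] less.prems by auto
  qed
  then show "upper_triangular D"
    using D by auto
  fix i assume i: "i < n"
  have "D $$ (i, i) * U $$ (i, i) = 1"
    using trunc[of i i] entry[of i i] zero[of _ i] i by auto
  then show "D $$ (i, i) = inverse (U $$ (i, i))"
    by (metis inverse_unique mult.commute)
qed

lemma upper_triangular_pow:
  fixes D :: "'a :: comm_ring_1 mat"
  assumes D: "D \<in> carrier_mat n n" "upper_triangular D"
  shows "upper_triangular (D ^\<^sub>m k)" "\<And>i. i < n \<Longrightarrow> (D ^\<^sub>m k) $$ (i, i) = D $$ (i, i) ^ k"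
proof -
  have "upper_triangular (D ^\<^sub>m k) \<and> (\<forall>i<n. (D ^\<^sub>m k) $$ (i, i) = D $$ (i, i) ^ k)"
  proof (induction k)
    case 0
    then show ?case
      using D by auto
  next
    case (Suc k)
    let ?E = "D ^\<^sub>m k"
    have E: "?E \<in> carrier_mat n n"
      using D by simp
    have entry: "(D ^\<^sub>m Suc k) $$ (i, j) = (\<Sum>l<n. ?E $$ (i, l) * D $$ (l, j))"
      if "i < n" "j < n" for i j
      using D E that by (simp add: scalar_prod_def atLeast0LessThan)
    \<comment> \<open>Only indices between \<open>i\<close> and \<open>j\<close> contribute to entry
      \<open>(i, j)\<close>: none below the diagonal, exactly one on it.\<close>
    have vanish: "?E $$ (i, l) * D $$ (l, j) = 0" if "i < n" "l < n" "l < i \<or> j < l" for i j l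
      using that Suc.IH D E by (metis carrier_matD(1) mult_zero_left mult_zero_right upper_triangularD)
    have "upper_triangular (D ^\<^sub>m Suc k)"
    proof (rule upper_triangularI)
      fix i j assume ij: "j < i" "i < dim_row (D ^\<^sub>m Suc k)"
      then have "i < n" "j < n"
        using D by (auto simp: pow_mat_dim)
      moreover have "?E $$ (i, l) * D $$ (l, j) = 0" if "l < n" for l
        using vanish[of i l j] that \<open>i < n\<close> ij by linarith
      ultimately show "(D ^\<^sub>m Suc k) $$ (i, j) = 0"
        unfolding entry[OF \<open>i < n\<close> \<open>j < n\<close>] by (intro sum.neutral) auto
    qed
    moreover have "(D ^\<^sub>m Suc k) $$ (i, i) = D $$ (i, i) ^ Suc k" if "i < n" for i
    proof -
      have "(D ^\<^sub>m Suc k) $$ (i, i) = (\<Sum>l\<in>{i}. ?E $$ (i, l) * D $$ (l, i))"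
        unfolding entry[OF that that] using vanish[of i _ i] that
        by (intro sum.mono_neutral_right) (auto, metis linorder_neqE_nat mult_eq_0_iff)
      then show ?thesis
        using Suc.IH that by (simp add: mult.commute)
    qed
    ultimately show ?case
      by blast
  qed
  then show "upper_triangular (D ^\<^sub>m k)" "\<And>i. i < n \<Longrightarrow> (D ^\<^sub>m k) $$ (i, i) = D $$ (i, i) ^ k"
    by auto
qed

section \<open>Similarity invariance of the trace and the resolvent\<close>

lemma sum_diag_mult_comm:
  fixes X Y :: "'a :: comm_ring_1 mat"
  assumes X: "X \<in> carrier_mat n n" and Y: "Y \<in> carrier_mat n n"
  shows "(\<Sum>i<n. (X * Y) $$ (i, i)) = (\<Sum>i<n. (Y * X) $$ (i, i))"
proof -
  have "(\<Sum>i<n. (X * Y) $$ (i, i)) = (\<Sum>i<n. \<Sum>j<n. X $$ (i, j) * Y $$ (j, i))"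
    using X Y by (simp add: scalar_prod_def atLeast0LessThan)
  also have "\<dots> = (\<Sum>j<n. \<Sum>i<n. X $$ (i, j) * Y $$ (j, i))"
    by (rule sum.swap)
  also have "\<dots> = (\<Sum>i<n. (Y * X) $$ (i, i))"
    using X Y by (simp add: scalar_prod_def atLeast0LessThan mult.commute)
  finally show ?thesis .
qed

lemma sum_diag_similar:
  fixes C D :: "'a :: comm_ring_1 mat"
  assumes C: "C \<in> carrier_mat n n" and sim: "similar_mat_wit C D P Q"
  shows "(\<Sum>i<n. C $$ (i, i)) = (\<Sum>i<n. D $$ (i, i))"
proof -
  note * = similar_mat_witD2[OF C sim]
  have "(\<Sum>i<n. C $$ (i, i)) = (\<Sum>i<n. (P * (D * Q)) $$ (i, i))"
    using * by simp
  also have "\<dots> = (\<Sum>i<n. (D * Q * P) $$ (i, i))"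
    using * by (intro sum_diag_mult_comm) auto
  also have "D * Q * P = D"
    using * by simp
  finally show ?thesis .
qed

text \<open>A Schur decomposition makes \<open>A\<close> similar to an upper triangular
  \<open>T\<close> whose diagonal is \<open>es\<close>. The same similarity carries the inverse of
  \<open>u - A\<close> to an upper triangular matrix with diagonal entries
  \<open>inverse (u - e)\<close>. Powers act entrywise on that diagonal, and the trace does not
  change under similarity.\<close>

lemma resolvent_power_trace:
  fixes A :: "real mat"
  assumes A: "A \<in> carrier_mat n n"
    and cp: "char_poly A = (\<Prod>e\<leftarrow>es. [:- e, 1:])"
    and u: "u \<notin> set es"
  defines "C \<equiv> the (mat_inverse (u \<cdot>\<^sub>m 1\<^sub>m n - A))"
  shows "C \<in> carrier_mat n n"
    "(\<Sum>i<n. (C ^\<^sub>m k) $$ (i, i)) = (\<Sum>e\<leftarrow>es. inverse (u - e) ^ k)"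
proof -
  let ?A = "u \<cdot>\<^sub>m 1\<^sub>m n - A"
  obtain T P Q where TPQ: "schur_decomposition A es = (T, P, Q)"
    by (cases "schur_decomposition A es") auto
  note schur = schur_decomposition[OF A cp TPQ]
  note sim = similar_mat_witD2[OF A conjunct1[OF schur]]
  let ?U = "u \<cdot>\<^sub>m 1\<^sub>m n - T"
  have es: "es = map (\<lambda>i. T $$ (i, i)) [0..<n]"
    using schur sim by (auto simp: diag_mat_def)
  have U: "?U \<in> carrier_mat n n" "upper_triangular ?U"
  proof -
    show "?U \<in> carrier_mat n n"
      using sim by (intro minus_carrier_mat)
    show "upper_triangular ?U"
    proof (rule upper_triangularI)
      fix i j assume "j < i" "i < dim_row ?U"
      then show "?U $$ (i, j) = 0"
        using sim schur upper_triangularD[of T j i] by auto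
    qed
  qed
  have diag: "?U $$ (i, i) \<noteq> 0" if "i < n" for i
    using that sim u unfolding es by auto
  have PUQ: "?A = P * ?U * Q"
  proof -
    have "P * ?U * Q = (P * (u \<cdot>\<^sub>m 1\<^sub>m n) - P * T) * Q"
      using sim by (simp add: mult_minus_distrib_mat[of _ n n _ n])
    also have "\<dots> = P * (u \<cdot>\<^sub>m 1\<^sub>m n) * Q - P * T * Q"
      using sim by (intro minus_mult_distrib_mat[of _ n n]) auto
    also have "P * (u \<cdot>\<^sub>m 1\<^sub>m n) * Q = u \<cdot>\<^sub>m 1\<^sub>m n"
      using sim by (simp add: mult_smult_distrib[of _ n n _ n] mult_smult_assoc_mat[of _ n n _ n])
    finally show ?thesis
      using sim by simp
  qed
  have simU: "similar_mat_wit ?A ?U P Q"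
    using PUQ sim U(1) A unfolding similar_mat_wit_def by (auto simp: Let_def)
  \<comment> \<open>A nonzero determinant guarantees that \<open>mat_inverse\<close> returns an
    actual inverse, so that \<open>the\<close> in the definition of \<open>C\<close> is
    meaningful.\<close>
  have "det ?A = det ?U"
    using simU by (intro det_similar) (auto simp: similar_mat_def)
  also have "\<dots> \<noteq> 0"
    using U diag by (auto simp: det_upper_triangular[OF U(2) U(1)] prod_list_zero_iff diag_mat_def)
  finally have "?A \<in> Units (ring_mat TYPE(real) n ())"
    using A by (intro det_non_zero_imp_unit) auto
  then obtain B where "mat_inverse ?A = Some B"
    using mat_inverse(1)[OF minus_carrier_mat[OF A], where b = "()"] by (cases "mat_inverse ?A") auto
  then have C: "C \<in> carrier_mat n n" "C * ?A = 1\<^sub>m n" "?A * C = 1\<^sub>m n"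
    using mat_inverse(2)[OF minus_carrier_mat[OF A], of "u \<cdot>\<^sub>m 1\<^sub>m n" B] by (auto simp: C_def)
  show "C \<in> carrier_mat n n"
    by fact
  \<comment> \<open>\<open>D\<close> is \<open>C\<close> in the Schur basis; it will turn out to be
    a left inverse of the triangular matrix \<open>?U\<close>.\<close>
  define D where "D = Q * C * P"
  have D: "D \<in> carrier_mat n n"
    using sim C by (auto simp: D_def)
  have A': "?A \<in> carrier_mat n n"
    by (rule minus_carrier_mat[OF A])
  have QAP: "Q * ?A * P = ?U"
  proof -
    have "Q * ?A * P = Q * (P * ?U * Q) * P"
      by (simp only: PUQ)
    also have "\<dots> = (Q * P) * ?U * (Q * P)"
      using sim(5-7) U(1) by (simp add: assoc_mult_mat[of _ n n _ n _ n])
    finally show ?thesis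
      using sim U by simp
  qed
  have PDQ: "C = P * D * Q"
  proof -
    have "P * D * Q = (P * Q) * C * (P * Q)"
      using sim(5-7) C(1) unfolding D_def by (simp add: assoc_mult_mat[of _ n n _ n _ n])
    then show ?thesis
      using sim C by simp
  qed
  have "D * ?U = Q * C * ((P * Q) * ?A * P)"
    unfolding QAP[symmetric] D_def using sim(6,7) C(1) A'
    by (simp add: assoc_mult_mat[of _ n n _ n _ n])
  also have "\<dots> = Q * (C * ?A) * P"
  proof -
    have "P * Q * ?A = ?A"
      unfolding sim(1) by (rule left_mult_one_mat[OF A'])
    then show ?thesis
      using sim(6,7) C(1) A' by (simp add: assoc_mult_mat[of _ n n _ n _ n])
  qed
  also have "\<dots> = 1\<^sub>m n"
    using sim C by simp
  finally have DU: "D * ?U = 1\<^sub>m n" .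
  note inv = upper_triangular_inverse[OF U D DU diag]
  have simD: "similar_mat_wit C D P Q"
    using PDQ sim C D unfolding similar_mat_wit_def by (auto simp: Let_def)
  have "(\<Sum>i<n. (C ^\<^sub>m k) $$ (i, i)) = (\<Sum>i<n. (D ^\<^sub>m k) $$ (i, i))"
    using C by (intro sum_diag_similar[OF _ similar_mat_wit_pow[OF simD]]) auto
  also have "\<dots> = (\<Sum>i<n. inverse (u - T $$ (i, i)) ^ k)"
    using upper_triangular_pow(2)[OF D inv(1)] inv(2) sim by (intro sum.cong) auto
  also have "\<dots> = (\<Sum>e\<leftarrow>es. inverse (u - e) ^ k)"
    unfolding es by (simp add: o_def interv_sum_list_conv_sum_set_nat atLeast0LessThan)
  finally show "(\<Sum>i<n. (C ^\<^sub>m k) $$ (i, i)) = (\<Sum>e\<leftarrow>es. inverse (u - e) ^ k)" .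
qed

text \<open>Maximum principle: let \<open>m\<close> be a coordinate where the eigenvector
  \<open>v\<close> is largest in absolute value. Since row \<open>m\<close> sums to zero,
  \<open>v $ m * v $ m\<close> may be subtracted inside the sum for
  \<open>e * v $ m * v $ m\<close>, and then every term is nonpositive.\<close>

lemma zero_row_sum_eigenvalue_nonpos:
  fixes A :: "real mat"
  assumes A: "A \<in> carrier_mat n n"
    and off: "\<And>i j. i < n \<Longrightarrow> j < n \<Longrightarrow> i \<noteq> j \<Longrightarrow> 0 \<le> A $$ (i, j)"
    and rows: "\<And>i. i < n \<Longrightarrow> (\<Sum>j<n. A $$ (i, j)) = 0"
    and ev: "eigenvalue A e"
  shows "e \<le> 0"
proof -
  obtain v where v: "v \<in> carrier_vec n" "v \<noteq> 0\<^sub>v n" "A *\<^sub>v v = e \<cdot>\<^sub>v v"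
    using ev A unfolding eigenvalue_def eigenvector_def by auto
  have n: "n \<noteq> 0"
    using v by (metis carrier_vecD eq_vecI index_zero_vec(2) less_zeroE)
  define V where "V = Max ((\<lambda>i. \<bar>v $ i\<bar>) ` {..<n})"
  have "V \<in> (\<lambda>i. \<bar>v $ i\<bar>) ` {..<n}"
    unfolding V_def using n by (intro Max_in) auto
  then obtain m where m: "m < n" "\<bar>v $ m\<bar> = V"
    by auto
  have le: "\<bar>v $ j\<bar> \<le> \<bar>v $ m\<bar>" if "j < n" for j
    unfolding m V_def using that by (intro Max_ge) auto
  have "v $ m \<noteq> 0"
  proof
    assume "v $ m = 0"
    then have "v = 0\<^sub>v n"
      using v(1) le by (intro eq_vecI) auto
    then show False
      using v(2) by simp
  qed
  have "e * v $ m = (A *\<^sub>v v) $ m"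
    using v m by simp
  also have "\<dots> = (\<Sum>j<n. A $$ (m, j) * v $ j)"
    using A v(1) m by (simp add: scalar_prod_def atLeast0LessThan)
  finally have "e * v $ m * v $ m = (\<Sum>j<n. A $$ (m, j) * (v $ j * v $ m))"
    by (simp add: sum_distrib_right mult.assoc)
  also have "\<dots> = (\<Sum>j<n. A $$ (m, j) * (v $ j * v $ m - v $ m * v $ m))"
    using rows[OF m(1)] by (simp add: right_diff_distrib sum_subtractf flip: sum_distrib_right)
  also have "\<dots> \<le> 0"
  proof (rule sum_nonpos)
    fix j assume j: "j \<in> {..<n}"
    have "v $ j * v $ m \<le> \<bar>v $ j\<bar> * \<bar>v $ m\<bar>"
      by (metis abs_ge_self abs_mult)
    also have "\<dots> \<le> \<bar>v $ m\<bar> * \<bar>v $ m\<bar>"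
      using le j by (intro mult_right_mono) auto
    finally have "v $ j * v $ m - v $ m * v $ m \<le> 0"
      by simp
    then show "A $$ (m, j) * (v $ j * v $ m - v $ m * v $ m) \<le> 0"
      using off[of m j] m j by (cases "j = m") (auto simp: mult_nonneg_nonpos)
  qed
  finally have "e * (v $ m * v $ m) \<le> 0"
    by (simp add: mult.assoc)
  moreover have "0 < v $ m * v $ m"
    using \<open>v $ m \<noteq> 0\<close> by (metis not_real_square_gt_zero)
  ultimately show ?thesis
    by (metis mult_pos_pos not_le)
qed

text \<open>The constant vector is an eigenvector. Applied to the Laplacian, this eigenvalue is what
  makes the resolvent traces blow up as \<open>u\<close> tends to 0.\<close>

lemma zero_row_sum_eigenvalue_zero:
  fixes A :: "real mat"
  assumes A: "A \<in> carrier_mat n n" and n: "0 < n"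
    and rows: "\<And>i. i < n \<Longrightarrow> (\<Sum>j<n. A $$ (i, j)) = 0"
  shows "eigenvalue A 0"
proof -
  let ?v = "vec n (\<lambda>_. 1) :: real vec"
  have "?v $ 0 \<noteq> 0\<^sub>v n $ 0"
    using n by simp
  then have "?v \<noteq> 0\<^sub>v n"
    by metis
  moreover have "A *\<^sub>v ?v = 0 \<cdot>\<^sub>v ?v"
    using A rows by (intro eq_vecI) (auto simp: scalar_prod_def atLeast0LessThan)
  ultimately show ?thesis
    using A unfolding eigenvalue_def eigenvector_def by (intro exI[of _ ?v]) auto
qed

section \<open>The torus Laplacian and the spectral form of its resolvent traces\<close>

lemma torus_adj_sym: "torus_adj L d x y \<longleftrightarrow> torus_adj L d y x"
  unfolding torus_adj_def by metis

lemma finite_torus: "finite (torus L d)"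
  by (auto simp: torus_def intro: finite_PiE)

lemma torus_laplacian_row_sum:
  assumes "x \<in> torus L d"
  shows "(\<Sum>y\<in>torus L d. torus_laplacian L d x y) = 0"
proof -
  have nbr: "{y \<in> torus L d. y \<noteq> x \<and> torus_adj L d x y} = Collect (torus_adj L d x)"
    by (auto simp: torus_adj_def)
  have "(\<Sum>y\<in>torus L d. torus_laplacian L d x y) =
      torus_laplacian L d x x + (\<Sum>y\<in>torus L d - {x}. torus_laplacian L d x y)"
    using assms by (intro sum.remove finite_torus)
  also have "(\<Sum>y\<in>torus L d - {x}. torus_laplacian L d x y) =
      (\<Sum>y\<in>torus L d - {x}. if torus_adj L d x y then 1 else 0)"
    by (intro sum.cong) (auto simp: torus_laplacian_def)
  also have "\<dots> = real (card {z. torus_adj L d x z})"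
    by (subst sum.If_cases) (auto simp: finite_torus nbr Int_def)
  finally show ?thesis
    by (simp add: torus_laplacian_def)
qed

text \<open>The list \<open>ls\<close> consists of the eigenvalues of minus \<open>t\<close> times
  the Laplacian, with multiplicity. They are nonnegative by the maximum principle, so every
  \<open>u > 0\<close> avoids the spectrum. The bounds and the derivative of the resolvent traces
  are read off from this formula.\<close>

lemma resolvent_trace_spectral:
  assumes "1 \<le> L" and "0 < t"
  obtains ls where "length ls = L ^ d" "\<And>l. l \<in> set ls \<Longrightarrow> 0 \<le> l" "0 \<in> set ls"
    "\<And>i u. 0 < u \<Longrightarrow> resolvent_trace L d t i u = (\<Sum>l\<leftarrow>ls. inverse (u + l) ^ i) / real (L ^ d)"
proof -
  let ?n = "L ^ d"
  let ?A = "t \<cdot>\<^sub>m laplacian_mat L d"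
  have A: "?A \<in> carrier_mat ?n ?n"
    by (simp add: laplacian_mat_def)
  have entry: "?A $$ (i, j) = t * torus_laplacian L d (site L d i) (site L d j)"
    if "i < ?n" "j < ?n" for i j
    using that by (simp add: laplacian_mat_def)
  note bij = bij_betw_site[OF assms(1), of d]
  have sym: "?A $$ (i, j) = ?A $$ (j, i)" if "i < ?n" "j < ?n" for i j
    using that by (simp only: entry) (auto simp: torus_laplacian_def torus_adj_sym)
  have off: "0 \<le> ?A $$ (i, j)" if "i < ?n" "j < ?n" "i \<noteq> j" for i j
  proof -
    \<comment> \<open>Injectivity of the enumeration of sites keeps the negative diagonal values of
      the Laplacian out of the off-diagonal matrix entries.\<close>
    have "site L d i \<noteq> site L d j"
      using bij_betw_imp_inj_on[OF bij] that by (auto simp: inj_on_def)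
    then show ?thesis
      using assms(2) that by (simp only: entry) (simp add: torus_laplacian_def)
  qed
  have rows: "(\<Sum>j<?n. ?A $$ (i, j)) = 0" if "i < ?n" for i
  proof -
    have "(\<Sum>j<?n. ?A $$ (i, j)) = t * (\<Sum>j<?n. torus_laplacian L d (site L d i) (site L d j))"
      using that by (simp add: entry sum_distrib_left del: index_smult_mat)
    also have "(\<Sum>j<?n. torus_laplacian L d (site L d i) (site L d j)) =
        (\<Sum>y\<in>torus L d. torus_laplacian L d (site L d i) y)"
      by (rule sum.reindex_bij_betw[OF bij])
    also have "\<dots> = 0"
      using that bij by (intro torus_laplacian_row_sum) (auto simp: bij_betw_def)
    finally show ?thesis
      by simp
  qed
  obtain es where es: "char_poly ?A = (\<Prod>e\<leftarrow>es. [:- e, 1:])" "length es = ?n"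
    using symmetric_mat_char_poly_splits[OF A sym] by blast
  have root: "e \<in> set es \<longleftrightarrow> eigenvalue ?A e" for e
    unfolding eigenvalue_root_char_poly[OF A] es(1) by (auto simp: poly_prod_list prod_list_zero_iff)
  have nonpos: "e \<le> 0" if "e \<in> set es" for e
    using zero_row_sum_eigenvalue_nonpos[OF A off rows] that root by blast
  show thesis
  proof (rule that[of "map uminus es"])
    show "length (map uminus es) = ?n"
      using es by simp
    show "0 \<le> l" if "l \<in> set (map uminus es)" for l
      using that nonpos by auto
    have "0 \<in> set es"
      using zero_row_sum_eigenvalue_zero[OF A _ rows] assms(1) root by simp
    then show "0 \<in> set (map uminus es)"
      by force
    fix i u assume "(0::real) < u"
    then have u: "u \<notin> set es"
      using nonpos by force
    note res = resolvent_power_trace[OF A es(1) u]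
    have dim: "dim_row (the (mat_inverse (u \<cdot>\<^sub>m 1\<^sub>m ?n - ?A)) ^\<^sub>m i) = ?n"
      using res(1) by simp
    show "resolvent_trace L d t i u = (\<Sum>l\<leftarrow>map uminus es. inverse (u + l) ^ i) / real ?n"
      unfolding resolvent_trace_def normalized_trace_def dim res(2) by (simp add: o_def)
  qed
qed

section \<open>The correlation function\<close>

lemma measurable_borel_imp_correlation:
  assumes "correlation_measure \<nu>" and "f \<in> borel_measurable borel"
  shows "f \<in> borel_measurable \<nu>"
proof -
  have "f \<in> borel_measurable (restrict_space borel {0<..})"
    using assms(2) by (rule measurable_restrict_space1)
  then show ?thesis
    using assms(1) measurable_cong_sets[of \<nu> "restrict_space borel {0<..}" borel borel]
    by (auto simp: correlation_measure_def)
qed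

lemma space_correlation_measure:
  assumes "correlation_measure \<nu>"
  shows "space \<nu> = {0<..}"
  using assms sets_eq_imp_space_eq[of \<nu> "restrict_space borel {0<..}"]
  by (simp add: correlation_measure_def space_restrict_space)

text \<open>Up to the sign \<open>(-1)\<^sup>k\<close>, this is the \<open>k\<close>-th derivative of \<open>B\<close>.\<close>

definition correlation_moment :: "real measure \<Rightarrow> nat \<Rightarrow> real \<Rightarrow> real" where
  "correlation_moment \<nu> k x = (\<integral> l. (l\<^sup>2) ^ k * exp (- (l\<^sup>2 * x)) \<partial>\<nu>)"

text \<open>The gap between \<open>x\<close> and \<open>- \<epsilon>\<close> leaves a spare
  exponential factor that absorbs the power of \<open>l\<^sup>2\<close>, so the assumed exponential
  moment dominates the integrand.\<close>

lemma integrable_correlation_moment: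
  assumes \<nu>: "correlation_measure \<nu>"
    and \<epsilon>: "(\<integral>\<^sup>+ l. ennreal (exp (\<epsilon> * l\<^sup>2)) \<partial>\<nu>) < \<infinity>" and x: "- \<epsilon> < x"
  shows "integrable \<nu> (\<lambda>l. (l\<^sup>2) ^ k * exp (- (l\<^sup>2 * x)))"
proof -
  \<comment> \<open>This gives \<open>k * c \<le> x + \<epsilon>\<close>, hence
    \<open>(c * y) ^ k \<le> exp ((x + \<epsilon>) * y)\<close>. Dividing by \<open>Suc k\<close>
    instead of \<open>k\<close> also covers \<open>k = 0\<close>.\<close>
  define c where "c = (x + \<epsilon>) / real (Suc k)"
  have c: "0 < c" "real k * c \<le> x + \<epsilon>"
    using x by (auto simp: c_def field_simps)
  have bound: "y ^ k * exp (- (y * x)) \<le> exp (\<epsilon> * y) / c ^ k" if y: "0 \<le> y" for y :: real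
  proof -
    have "c * y \<le> exp (c * y)"
      using exp_ge_add_one_self[of "c * y"] by linarith
    then have "(c * y) ^ k \<le> exp (c * y) ^ k"
      using c y by (intro power_mono) auto
    also have "\<dots> = exp (real k * c * y)"
      unfolding exp_of_nat_mult[symmetric] by (simp add: mult.assoc)
    also have "\<dots> \<le> exp ((x + \<epsilon>) * y)"
      using c y by (auto intro: mult_right_mono)
    finally have "(c * y) ^ k * exp (- (y * x)) \<le> exp ((x + \<epsilon>) * y) * exp (- (y * x))"
      by (intro mult_right_mono) auto
    also have "\<dots> = exp (\<epsilon> * y)"
      unfolding exp_add[symmetric] by (simp add: algebra_simps)
    finally show ?thesis
      using c by (simp add: power_mult_distrib field_simps)
  qed
  have "integrable \<nu> (\<lambda>l. exp (\<epsilon> * l\<^sup>2))"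
    using \<epsilon> by (intro integrableI_nonneg measurable_borel_imp_correlation[OF \<nu>]) auto
  then have "integrable \<nu> (\<lambda>l. exp (\<epsilon> * l\<^sup>2) / c ^ k)"
    by simp
  then show ?thesis
  proof (rule Bochner_Integration.integrable_bound)
    show "(\<lambda>l. (l\<^sup>2) ^ k * exp (- (l\<^sup>2 * x))) \<in> borel_measurable \<nu>"
      by (intro measurable_borel_imp_correlation[OF \<nu>]) simp
    show "AE l in \<nu>. norm ((l\<^sup>2) ^ k * exp (- (l\<^sup>2 * x))) \<le> norm (exp (\<epsilon> * l\<^sup>2) / c ^ k)"
      using bound[OF zero_le_power2] c by (simp add: abs_mult)
  qed
qed

section \<open>Differentiation under the integral sign\<close>

lemma exp_minus_linear_bound:
  fixes z :: real
  shows "\<bar>exp z - 1 - z\<bar> \<le> z\<^sup>2 * exp \<bar>z\<bar>"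
proof -
  obtain s where s: "\<bar>s\<bar> \<le> \<bar>z\<bar>" "exp z = (\<Sum>m<2. z ^ m / fact m) + exp s / fact 2 * z ^ 2"
    using Maclaurin_exp_le by blast
  then have "\<bar>exp z - 1 - z\<bar> = exp s / 2 * z\<^sup>2"
    by (simp add: numeral_2_eq_2 abs_mult)
  also have "\<dots> \<le> exp \<bar>z\<bar> * z\<^sup>2"
  proof (intro mult_right_mono)
    have "exp s \<le> exp \<bar>z\<bar>"
      using s(1) by simp
    then show "exp s / 2 \<le> exp \<bar>z\<bar>"
      using exp_gt_zero[of s] by linarith
  qed auto
  finally show ?thesis
    by (simp add: mult.commute)
qed

text \<open>The pointwise Taylor remainder of the exponential is integrated: the difference quotient
  misses the claimed derivative by at most \<open>\<bar>h\<bar>\<close> times a fixed moment two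
  orders higher, taken at \<open>x - r\<close>.\<close>

lemma correlation_moment_has_derivative:
  assumes \<nu>: "correlation_measure \<nu>"
    and \<epsilon>: "(\<integral>\<^sup>+ l. ennreal (exp (\<epsilon> * l\<^sup>2)) \<partial>\<nu>) < \<infinity>" and x: "- \<epsilon> < x"
  shows "(correlation_moment \<nu> k has_real_derivative - correlation_moment \<nu> (Suc k) x) (at x)"
proof -
  let ?G = "correlation_moment \<nu>"
  note int = integrable_correlation_moment[OF \<nu> \<epsilon>]
  \<comment> \<open>Half the distance to \<open>- \<epsilon>\<close>: moving from \<open>x\<close>
    to \<open>x - r\<close> pays for the remainder factor \<open>exp (y * \<bar>h\<bar>)\<close>
    when \<open>\<bar>h\<bar> < r\<close>, and moments still exist at \<open>x - r\<close>.\<close>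
  define r where "r = (x + \<epsilon>) / 2"
  have r: "0 < r" "- \<epsilon> < x - r"
    using x by (auto simp: r_def field_simps)
  have est: "\<bar>(?G k (x + h) - ?G k x) / h - - ?G (Suc k) x\<bar> \<le> \<bar>h\<bar> * ?G (k + 2) (x - r)"
    if h: "h \<noteq> 0" "\<bar>h\<bar> < r" for h
  proof -
    let ?g = "\<lambda>k x (l::real). (l\<^sup>2) ^ k * exp (- (l\<^sup>2 * x)) :: real"
    have xh: "- \<epsilon> < x + h"
      using h r by linarith
    have eq: "?G k (x + h) - ?G k x + h * ?G (Suc k) x =
        (\<integral>l. ?g k (x + h) l - ?g k x l + h * ?g (Suc k) x l \<partial>\<nu>)"
      unfolding correlation_moment_def
      by (simp only: Bochner_Integration.integral_add Bochner_Integration.integral_diff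
          integral_mult_right_zero Bochner_Integration.integrable_diff integrable_mult_right int xh x)
    have "\<bar>?G k (x + h) - ?G k x + h * ?G (Suc k) x\<bar> \<le> (\<integral>l. h\<^sup>2 * ?g (k + 2) (x - r) l \<partial>\<nu>)"
      unfolding eq
    proof (rule integral_abs_bound_integral)
      show "integrable \<nu> (\<lambda>l. ?g k (x + h) l - ?g k x l + h * ?g (Suc k) x l)"
        by (intro Bochner_Integration.integrable_add Bochner_Integration.integrable_diff
            integrable_mult_right int xh x)
      show "integrable \<nu> (\<lambda>l. h\<^sup>2 * ?g (k + 2) (x - r) l)"
        by (intro integrable_mult_right int r)
      fix l :: real
      define y where "y = l\<^sup>2"
      have y: "0 \<le> y"
        by (simp add: y_def)
      let ?z = "- (y * h)"
      have e: "exp (- (y * (x + h))) = exp (- (y * x)) * exp ?z"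
        unfolding exp_add[symmetric] by (simp add: algebra_simps)
      have "y ^ k * exp (- (y * (x + h))) - y ^ k * exp (- (y * x)) + h * (y ^ Suc k * exp (- (y * x)))
          = y ^ k * exp (- (y * x)) * (exp ?z - 1 - ?z)"
        unfolding e by (simp add: algebra_simps)
      also have "\<bar>\<dots>\<bar> \<le> y ^ k * exp (- (y * x)) * (?z\<^sup>2 * exp \<bar>?z\<bar>)"
        using y exp_minus_linear_bound[of ?z] by (simp add: abs_mult mult_left_mono)
      also have "\<dots> = h\<^sup>2 * (y ^ (k + 2) * (exp (- (y * x)) * exp (y * \<bar>h\<bar>)))"
      proof -
        have "\<bar>?z\<bar> = y * \<bar>h\<bar>" "?z\<^sup>2 = y\<^sup>2 * h\<^sup>2"
          using y by (simp_all add: abs_mult power_mult_distrib)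
        then show ?thesis
          by (simp only: power_add mult_ac)
      qed
      also have "\<dots> \<le> h\<^sup>2 * (y ^ (k + 2) * exp (- (y * (x - r))))"
      proof -
        have "y * \<bar>h\<bar> \<le> y * r"
          using y h by (intro mult_left_mono) auto
        then have "exp (- (y * x)) * exp (y * \<bar>h\<bar>) \<le> exp (- (y * (x - r)))"
          unfolding exp_add[symmetric] by (simp add: algebra_simps)
        then show ?thesis
          using y by (intro mult_left_mono) auto
      qed
      finally show "\<bar>?g k (x + h) l - ?g k x l + h * ?g (Suc k) x l\<bar> \<le> h\<^sup>2 * ?g (k + 2) (x - r) l"
        unfolding y_def .
    qed
    also have "\<dots> = h\<^sup>2 * ?G (k + 2) (x - r)"
      unfolding correlation_moment_def by (rule integral_mult_right_zero)
    finally have *: "\<bar>?G k (x + h) - ?G k x + h * ?G (Suc k) x\<bar> \<le> h\<^sup>2 * ?G (k + 2) (x - r)" .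
    have "\<bar>(?G k (x + h) - ?G k x) / h - - ?G (Suc k) x\<bar>
        = \<bar>?G k (x + h) - ?G k x + h * ?G (Suc k) x\<bar> / \<bar>h\<bar>"
      using h by (simp add: field_simps flip: abs_divide)
    also have "\<dots> \<le> h\<^sup>2 * ?G (k + 2) (x - r) / \<bar>h\<bar>"
      using * by (simp add: divide_right_mono)
    also have "\<dots> = \<bar>h\<bar> * ?G (k + 2) (x - r)"
    proof -
      have "h\<^sup>2 / \<bar>h\<bar> = \<bar>h\<bar>"
        by (simp add: power2_eq_square field_simps abs_if)
      then show ?thesis
        by (metis times_divide_eq_left)
    qed
    finally show ?thesis .
  qed
  have "((\<lambda>h. (?G k (x + h) - ?G k x) / h - - ?G (Suc k) x) \<longlongrightarrow> 0) (at 0)"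
  proof (rule Lim_null_comparison)
    show "\<forall>\<^sub>F h in at 0. norm ((?G k (x + h) - ?G k x) / h - - ?G (Suc k) x)
        \<le> \<bar>h\<bar> * ?G (k + 2) (x - r)"
      unfolding eventually_at using r est by (auto intro!: exI[of _ r] simp: dist_real_def)
    show "((\<lambda>h. \<bar>h\<bar> * ?G (k + 2) (x - r)) \<longlongrightarrow> 0) (at 0)"
      by (auto intro!: tendsto_eq_intros)
  qed
  then show ?thesis
    unfolding DERIV_def by (rule LIM_zero_cancel)
qed

lemma B_fun_eq_correlation_moment: "B_fun \<nu> = correlation_moment \<nu> 0"
  by (simp add: fun_eq_iff B_fun_def correlation_moment_def)

lemma
  assumes \<nu>: "correlation_measure \<nu>"
  shows correlation_moment_deriv: "0 \<le> x \<Longrightarrow>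
      (correlation_moment \<nu> k has_real_derivative - correlation_moment \<nu> (Suc k) x) (at x)"
    and deriv_B_fun: "0 \<le> x \<Longrightarrow> deriv (B_fun \<nu>) x = - correlation_moment \<nu> 1 x"
    and deriv2_B_fun_0: "deriv (deriv (B_fun \<nu>)) 0 = correlation_moment \<nu> 2 0"
    and correlation_moment_pos: "0 \<le> x \<Longrightarrow> 0 < correlation_moment \<nu> k x"
    and correlation_moment_strict_antimono: "0 \<le> x \<Longrightarrow> x < y \<Longrightarrow>
      correlation_moment \<nu> k y < correlation_moment \<nu> k x"
proof -
  obtain \<epsilon> where \<epsilon>: "0 < \<epsilon>" "(\<integral>\<^sup>+ l. ennreal (exp (\<epsilon> * l\<^sup>2)) \<partial>\<nu>) < \<infinity>"
    using \<nu> by (auto simp: correlation_measure_def)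
  note der = correlation_moment_has_derivative[OF \<nu> \<epsilon>(2)]
  note int = integrable_correlation_moment[OF \<nu> \<epsilon>(2)]
  interpret finite_measure \<nu>
    using \<nu> by (simp add: correlation_measure_def)
  have ne: "emeasure \<nu> (space \<nu>) \<noteq> 0"
    using \<nu> by (simp add: correlation_measure_def)
  show "0 \<le> x \<Longrightarrow>
      (correlation_moment \<nu> k has_real_derivative - correlation_moment \<nu> (Suc k) x) (at x)"
    using der \<epsilon> by auto
  \<comment> \<open>The range includes negative arguments because the second derivative at 0 needs
    this formula on a whole neighbourhood of 0.\<close>
  have B1: "deriv (B_fun \<nu>) x = - correlation_moment \<nu> 1 x" if "- \<epsilon> < x" for x
    using der[OF that, of 0] by (simp add: B_fun_eq_correlation_moment DERIV_imp_deriv)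
  then show "0 \<le> x \<Longrightarrow> deriv (B_fun \<nu>) x = - correlation_moment \<nu> 1 x"
    using \<epsilon> by auto
  have "(deriv (B_fun \<nu>) has_real_derivative correlation_moment \<nu> 2 0) (at 0)"
  proof (rule has_field_derivative_transform_within_open[where S = "{- \<epsilon><..}"])
    show "((\<lambda>x. - correlation_moment \<nu> 1 x) has_real_derivative correlation_moment \<nu> 2 0) (at 0)"
      using der[of 0 1] \<epsilon> by (auto intro!: derivative_eq_intros simp: numeral_2_eq_2)
  qed (use \<epsilon> B1 in auto)
  then show "deriv (deriv (B_fun \<nu>)) 0 = correlation_moment \<nu> 2 0"
    by (rule DERIV_imp_deriv)
  show "0 < correlation_moment \<nu> k x" if "0 \<le> x"
  proof -
    \<comment> \<open>The integrand is positive at every \<open>l > 0\<close>, and \<nu> is a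
      nonzero measure on that half-line, so the strict inequality survives integration. Strict
      monotonicity follows in the same way.\<close>
    have "(\<integral>l. 0 \<partial>\<nu>) < correlation_moment \<nu> k x"
      unfolding correlation_moment_def using that \<epsilon> ne
      by (intro integral_less_AE_space int) (auto simp: space_correlation_measure[OF \<nu>])
    then show ?thesis
      by simp
  qed
  show "correlation_moment \<nu> k y < correlation_moment \<nu> k x" if "0 \<le> x" "x < y"
    unfolding correlation_moment_def using that \<epsilon> ne
    by (intro integral_less_AE_space int) (auto simp: space_correlation_measure[OF \<nu>])
qed

section \<open>The resolvent traces and the Larkin mass\<close>

context
  fixes L d :: nat and t :: real
  assumes L: "1 \<le> L" and t: "0 < t"
begin

private abbreviation R :: "nat \<Rightarrow> real \<Rightarrow> real" where
  "R \<equiv> resolvent_trace L d t"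

text \<open>The eigenvalue 0 alone contributes the left-hand side, and all other terms are
  nonnegative. The bound yields positivity and the growth near 0 that forces a Larkin mass to
  exist.\<close>

lemma resolvent_trace_ge:
  assumes "0 < u"
  shows "inverse u ^ i / real (L ^ d) \<le> R i u"
proof -
  obtain ls where ls: "length ls = L ^ d" "\<And>l. l \<in> set ls \<Longrightarrow> 0 \<le> l" "0 \<in> set ls"
    "\<And>i u. 0 < u \<Longrightarrow> R i u = (\<Sum>l\<leftarrow>ls. inverse (u + l) ^ i) / real (L ^ d)"
    using resolvent_trace_spectral[OF L t] by metis
  have nonneg: "0 \<le> inverse (u + l) ^ i" if "l \<in> set ls" for l
    using ls(2)[OF that] assms by simp
  have "inverse u ^ i \<in> set (map (\<lambda>l. inverse (u + l) ^ i) ls)"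
    using ls(3) by force
  then have "inverse u ^ i \<le> (\<Sum>l\<leftarrow>ls. inverse (u + l) ^ i)"
    using nonneg by (intro member_le_sum_list) auto
  then show ?thesis
    using assms by (simp add: ls(4) divide_right_mono)
qed

lemma resolvent_trace_pos:
  assumes "0 < u"
  shows "0 < R i u"
proof -
  have "0 < inverse u ^ i / real (L ^ d)"
    using assms L by simp
  also note resolvent_trace_ge[OF assms]
  finally show ?thesis .
qed

lemma resolvent_trace_le:
  assumes "0 < u"
  shows "R i u \<le> inverse u ^ i"
proof -
  obtain ls where ls: "length ls = L ^ d" "\<And>l. l \<in> set ls \<Longrightarrow> 0 \<le> l" "0 \<in> set ls"
    "\<And>i u. 0 < u \<Longrightarrow> R i u = (\<Sum>l\<leftarrow>ls. inverse (u + l) ^ i) / real (L ^ d)"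
    using resolvent_trace_spectral[OF L t] by metis
  have "(\<Sum>l\<leftarrow>ls. inverse (u + l) ^ i) \<le> (\<Sum>l\<leftarrow>ls. inverse u ^ i)"
    using assms ls(2) by (intro sum_list_mono power_mono le_imp_inverse_le) force+
  also have "\<dots> = real (L ^ d) * inverse u ^ i"
    by (simp add: sum_list_triv ls(1))
  finally show ?thesis
    using assms L by (simp add: ls(4) field_simps)
qed

lemma resolvent_trace_has_derivative:
  assumes "0 < u"
  shows "(R i has_real_derivative - real i * R (Suc i) u) (at u)"
proof -
  obtain ls where ls: "length ls = L ^ d" "\<And>l. l \<in> set ls \<Longrightarrow> 0 \<le> l" "0 \<in> set ls"
    "\<And>i u. 0 < u \<Longrightarrow> R i u = (\<Sum>l\<leftarrow>ls. inverse (u + l) ^ i) / real (L ^ d)"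
    using resolvent_trace_spectral[OF L t] by metis
  have "((\<lambda>u. \<Sum>l\<leftarrow>ls. inverse (u + l) ^ i) has_real_derivative
      - real i * (\<Sum>l\<leftarrow>ls. inverse (u + l) ^ Suc i)) (at u)"
    using ls(2)
  proof (induction ls)
    case (Cons l ls)
    have ul: "u + l \<noteq> 0"
      using Cons.prems[of l] assms by simp
    have "((\<lambda>u. inverse (u + l) ^ i) has_real_derivative - real i * inverse (u + l) ^ Suc i) (at u)"
    proof -
      have "((\<lambda>u. inverse (u + l)) has_real_derivative - (inverse (u + l) ^ 2)) (at u)"
        using ul by (auto intro!: derivative_eq_intros simp: power2_eq_square)
      \<comment> \<open>The power rule involves the truncated exponent \<open>i - 1\<close>; for
        \<open>i = 0\<close> both sides are zero.\<close>
      from DERIV_power[OF this, of i] show ?thesis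
        by (rule DERIV_cong) (cases i; simp add: power2_eq_square algebra_simps)
    qed
    from DERIV_add[OF this Cons.IH] show ?case
      using Cons.prems by (simp add: algebra_simps)
  qed auto
  then have "((\<lambda>u. (\<Sum>l\<leftarrow>ls. inverse (u + l) ^ i) / real (L ^ d)) has_real_derivative
      - real i * R (Suc i) u) (at u)"
    unfolding ls(4)[OF assms] by (auto dest: DERIV_cdivide)
  then show ?thesis
    \<comment> \<open>The spectral formula is known only for positive arguments, an open set
      containing \<open>u\<close>.\<close>
    by (rule has_field_derivative_transform_within_open[of _ _ _ "{0<..}"]) (use assms ls(4) in auto)
qed

lemma resolvent_trace_strict_antimono:
  assumes "0 < u" "u < v" "0 < i"
  shows "R i v < R i u"
proof (rule DERIV_neg_imp_decreasing[OF assms(2)])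
  fix x assume "u \<le> x" "x \<le> v"
  then have "0 < x"
    using assms by linarith
  then show "\<exists>y. (R i has_real_derivative y) (at x) \<and> y < 0"
    using resolvent_trace_has_derivative[of x i] resolvent_trace_pos[of x "Suc i"] assms(3)
    by (intro exI conjI) (auto simp: mult_neg_pos)
qed

lemma resolvent_trace_antimono:
  assumes "0 < u" "u \<le> v" "0 < i"
  shows "R i v \<le> R i u"
  using resolvent_trace_strict_antimono[of u v i] assms by (cases "u = v") auto

lemma continuous_on_resolvent_trace: "continuous_on {0<..} (R i)"
  using resolvent_trace_has_derivative
  by (intro DERIV_continuous_on) (auto intro: has_field_derivative_at_within)

section \<open>The functional inverse K and its derivative\<close>

lemma K_fun_resolvent_trace:
  assumes "0 < u"
  shows "K_fun L d t (R 1 u) = u"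
proof -
  have "inj_on (R 1) {0<..}"
  proof (rule inj_onI)
    fix v w assume "v \<in> {0<..}" "w \<in> {0<..}" "R 1 v = R 1 w"
    then show "v = w"
      using resolvent_trace_strict_antimono[of v w 1] resolvent_trace_strict_antimono[of w v 1]
      by (cases v w rule: linorder_cases) auto
  qed
  then show ?thesis
    using assms by (simp add: K_fun_def the_inv_into_f_f)
qed

text \<open>The inverse function theorem applies because the derivative of \<open>R\<^sub>1\<close>
  is \<open>- R\<^sub>2\<close>, which does not vanish; it supplies the differentiability of K
  itself.\<close>

lemma K_fun_has_derivative:
  assumes u: "0 < u"
  shows "(K_fun L d t has_real_derivative - inverse (R 2 u)) (at (R 1 u))"
proof -
  have R2: "0 < R 2 u"
    by (rule resolvent_trace_pos[OF u])
  have "(K_fun L d t has_derivative (*) (- inverse (R 2 u))) (at (R 1 u))"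
  proof (rule has_derivative_inverse_strong[where f = "R 1" and x = u and S = "{0<..}" and f' = "(*) (- R 2 u)"])
    show "(R 1 has_derivative (*) (- R 2 u)) (at u)"
      using resolvent_trace_has_derivative[OF u, of 1]
      by (simp add: has_field_derivative_def numeral_2_eq_2)
    show "(*) (- R 2 u) \<circ> (*) (- inverse (R 2 u)) = id"
      using R2 by (auto simp: fun_eq_iff)
  qed (use u continuous_on_resolvent_trace K_fun_resolvent_trace in auto)
  then show ?thesis
    by (simp add: has_field_derivative_def)
qed

text \<open>Intermediate values on \<open>{\<mu>..v}\<close> with
  \<open>v = max \<mu> (inverse y)\<close>, where \<open>R 1 v \<le> inverse v \<le> y\<close>. This
  lets facts about K at \<open>y\<close> be read off at a mass \<open>u \<ge> \<mu>\<close>.\<close>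

lemma resolvent_trace_1_surj:
  assumes "0 < \<mu>" "0 < y" "y \<le> R 1 \<mu>"
  obtains u where "\<mu> \<le> u" "R 1 u = y"
proof -
  define v where "v = max \<mu> (inverse y)"
  have v: "\<mu> \<le> v" "0 < v" "inverse y \<le> v"
    using assms(1,2) by (auto simp: v_def)
  have "inverse v \<le> y"
    using le_imp_inverse_le[OF v(3)] assms(2) by simp
  have "R 1 v \<le> y"
    using resolvent_trace_le[of v 1] v \<open>inverse v \<le> y\<close> by simp
  moreover have "continuous_on {\<mu>..v} (R 1)"
    using continuous_on_resolvent_trace by (rule continuous_on_subset) (use assms in auto)
  ultimately obtain u where "\<mu> \<le> u" "u \<le> v" "R 1 u = y"
    using IVT2'[of "R 1" v y \<mu>] assms v by auto
  then show thesis
    using that by blast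
qed

lemma deriv_K_fun_resolvent_trace:
  assumes "0 < \<mu>"
  shows "deriv (K_fun L d t) (R 1 \<mu>) = - inverse (R 2 \<mu>)"
  using K_fun_has_derivative[OF assms] by (rule DERIV_imp_deriv)

lemma deriv_K_fun_le:
  assumes "0 < \<mu>" "0 < y" "y \<le> R 1 \<mu>"
  shows "deriv (K_fun L d t) y \<le> - inverse (R 2 \<mu>)"
proof -
  obtain u where u: "\<mu> \<le> u" "R 1 u = y"
    using resolvent_trace_1_surj[OF assms] .
  then have "deriv (K_fun L d t) y = - inverse (R 2 u)"
    using deriv_K_fun_resolvent_trace[of u] assms by auto
  moreover have "inverse (R 2 \<mu>) \<le> inverse (R 2 u)"
    using u assms by (intro le_imp_inverse_le resolvent_trace_antimono resolvent_trace_pos) auto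
  ultimately show ?thesis
    by simp
qed

text \<open>On this interval the derivative of K is the composite
  \<open>- inverse (R 2 (K y))\<close>. Its continuity is what makes F differentiable later.\<close>

lemma continuous_on_deriv_K_fun:
  assumes "0 < \<mu>"
  shows "continuous_on {0<..R 1 \<mu>} (deriv (K_fun L d t))"
proof -
  let ?K = "K_fun L d t"
  have K: "0 < ?K y \<and> isCont ?K y \<and> deriv ?K y = - inverse (R 2 (?K y))" if "y \<in> {0<..R 1 \<mu>}" for y
  proof -
    obtain u where u: "\<mu> \<le> u" "R 1 u = y"
      using resolvent_trace_1_surj[OF assms] \<open>y \<in> _\<close> by auto
    then have "0 < u" "?K y = u"
      using assms K_fun_resolvent_trace[of u] by auto
    then show ?thesis
      using K_fun_has_derivative[of u] deriv_K_fun_resolvent_trace[of u] u(2) by (auto intro: DERIV_isCont)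
  qed
  have "continuous_on {0<..R 1 \<mu>} ?K"
    using K by (intro continuous_at_imp_continuous_on) auto
  then have "continuous_on {0<..R 1 \<mu>} (\<lambda>y. R 2 (?K y))"
    by (rule continuous_on_compose2[OF continuous_on_resolvent_trace]) (use K in auto)
  then have "continuous_on {0<..R 1 \<mu>} (\<lambda>y. - inverse (R 2 (?K y)))"
    using K resolvent_trace_pos[of "K_fun L d t _" 2]
    by (intro continuous_on_minus continuous_on_inverse ballI) (metis less_irrefl)+
  then show ?thesis
    by (rule continuous_on_eq) (use K in auto)
qed

text \<open>With \<open>c\<close> as below, \<open>c * R 2 u\<close> is strictly decreasing in
  \<open>u\<close> and crosses 1 exactly once, at some \<open>m\<close>. Hence the definite
  description denotes \<open>m\<close>, and comparing \<mu> with \<open>m\<close> means comparing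
  \<open>c * R 2 \<mu>\<close> with 1.\<close>

lemma larkin_mass_iff:
  assumes \<nu>: "correlation_measure \<nu>" and \<mu>: "0 < \<mu>"
  shows "larkin_mass \<nu> L d t \<le> \<mu> \<longleftrightarrow> 4 * correlation_moment \<nu> 2 0 * R 2 \<mu> \<le> 1"
proof -
  define c where "c = 4 * correlation_moment \<nu> 2 0"
  have c: "0 < c"
    using correlation_moment_pos[OF \<nu>, of 0 2] by (simp add: c_def)
  \<comment> \<open>Small enough that the lower bound on \<open>R 2 a\<close>, multiplied by
    \<open>c\<close>, is at least \<open>a / a\<^sup>2\<close>, which is at least 1.\<close>
  define a where "a = min 1 (c / real (L ^ d))"
  have a: "0 < a" "a \<le> 1" "a \<le> c / real (L ^ d)"
    using c L by (auto simp: a_def)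
  have lo: "1 \<le> c * R 2 a"
  proof -
    have "1 \<le> a / a\<^sup>2"
      using a by (simp add: power2_eq_square)
    also have "\<dots> \<le> c / real (L ^ d) / a\<^sup>2"
      using a(3) by (rule divide_right_mono) simp
    also have "\<dots> = c * (inverse a ^ 2 / real (L ^ d))"
      by (simp add: field_simps)
    also have "\<dots> \<le> c * R 2 a"
      using resolvent_trace_ge[OF a(1), of 2] c by (intro mult_left_mono) auto
    finally show ?thesis .
  qed
  \<comment> \<open>Chosen so that \<open>c \<le> b\<^sup>2\<close>, which makes the upper bound
    \<open>c * inverse b ^ 2\<close> at most 1.\<close>
  define b where "b = 1 + c"
  have b: "0 < b" "a \<le> b"
    using a c by (auto simp: b_def)
  have hi: "c * R 2 b \<le> 1"
  proof -
    have "c * R 2 b \<le> c * inverse b ^ 2"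
      using resolvent_trace_le[OF b(1), of 2] c by (intro mult_left_mono) auto
    also have "\<dots> \<le> 1"
    proof -
      have "c \<le> b\<^sup>2"
        using c by (simp add: b_def power2_eq_square algebra_simps)
      then show ?thesis
        using b by (simp add: power_inverse divide_le_eq_1 flip: divide_inverse)
    qed
    finally show ?thesis .
  qed
  have "continuous_on {a..b} (\<lambda>u. c * R 2 u)"
    by (intro continuous_on_mult continuous_on_const
        continuous_on_subset[OF continuous_on_resolvent_trace]) (use a in auto)
  then obtain m where "a \<le> m" "c * R 2 m = 1"
    using IVT2'[of "\<lambda>u. c * R 2 u" b 1 a] lo hi b(2) by blast
  then have m: "0 < m" "c * R 2 m = 1"
    using a(1) by auto
  have less: "c * R 2 v < c * R 2 u" if "0 < u" "u < v" for u v
    using resolvent_trace_strict_antimono[OF that, of 2] c by simp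
  have "larkin_mass \<nu> L d t = m"
    unfolding larkin_mass_def deriv2_B_fun_0[OF \<nu>] c_def[symmetric]
  proof (rule the_equality)
    fix v assume "0 < v \<and> c * R 2 v = 1"
    then show "v = m"
      using less[of v m] less[of m v] m by (cases v m rule: linorder_cases) auto
  qed (use m in simp)
  then show ?thesis
    unfolding c_def[symmetric] using less[of m \<mu>] less[of \<mu> m] m \<mu>
    by (cases m \<mu> rule: linorder_cases) auto
qed

end

section \<open>Maximisers of the Parisi functional\<close>

lemma (in prob_space) eq_return_if_prob_eq_1:
  assumes s: "{s} \<in> sets M" and 1: "measure M {s} = 1"
  shows "M = return M s"
proof (rule measure_eqI)
  fix A assume A: "A \<in> sets M"
  have "prob A = indicator A s"
  proof (cases "s \<in> A")
    case True
    then have "prob {s} \<le> prob A"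
      using A by (intro finite_measure_mono) auto
    then show ?thesis
      using True 1 prob_le_1[of A] by simp
  next
    case False
    then have "prob ({s} \<union> A) = 1 + prob A"
      using s A 1 by (subst finite_measure_Union) auto
    then show ?thesis
      using False prob_le_1[of "{s} \<union> A"] measure_nonneg[of M A] by simp
  qed
  then show "emeasure M A = emeasure (return M s) A"
    using A by (simp add: emeasure_eq_measure indicator_def)
qed simp

text \<open>The complement of the support is a union of relatively open null sets. By the Lindelof
  property countably many of them suffice.\<close>

lemma null_complement_measure_support:
  fixes M :: "'a :: second_countable_topology measure"
  assumes "\<And>U. open U \<Longrightarrow> U \<inter> space M \<in> sets M"
  shows "space M - measure_support M \<in> null_sets M"
proof -
  define F where "F = {U. open U \<and> emeasure M (U \<inter> space M) = 0}"
  obtain F' where F': "F' \<subseteq> F" "countable F'" "\<Union>F' = \<Union>F"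
    using Lindelof[of F] by (auto simp: F_def)
  have "(\<Union>U\<in>F'. U \<inter> space M) \<in> null_sets M"
    using F' assms by (intro null_sets_UN' null_setsI) (auto simp: F_def)
  also have "(\<Union>U\<in>F'. U \<inter> space M) = \<Union>F \<inter> space M"
    using F'(3) by auto
  also have "\<dots> = space M - measure_support M"
    by (auto simp: F_def measure_support_def)
  finally show ?thesis .
qed

text \<open>The support carries full mass, so it is nonempty; without two distinct points it is a
  singleton.\<close>

lemma atom_if_not_replica_symmetry_breaking:
  assumes "prob_space M" and "\<And>U. open U \<Longrightarrow> U \<inter> space M \<in> sets M" and "\<not> replica_symmetry_breaking M"
  obtains x where "measure M {x} = 1"
proof -
  interpret prob_space M
    by fact
  let ?S = "measure_support M"
  have null: "space M - ?S \<in> null_sets M"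
    using assms(2) by (rule null_complement_measure_support)
  have sub: "?S \<subseteq> space M"
    by (auto simp: measure_support_def)
  have "?S \<noteq> {}"
    using null prob_space by (auto simp: null_sets_def emeasure_eq_measure)
  then obtain x where "?S = {x}"
    using assms(3) by (auto simp: replica_symmetry_breaking_def)
  then have "prob {x} = prob (space M - (space M - ?S))"
    using sub by (simp add: double_diff)
  also have "\<dots> = 1"
    using null by (subst prob_compl) (auto simp: measure_def)
  finally show thesis
    by (rule that)
qed

section \<open>Regularity of \<delta>, F and f for a fixed Parisi pair\<close>

context
  fixes \<nu> :: "real measure" and L d :: nat and t \<beta> \<mu> q :: real and \<zeta> :: "real measure"
  assumes L: "1 \<le> L" and t: "0 < t" and \<nu>: "correlation_measure \<nu>"
    and \<beta>: "0 < \<beta>" and \<mu>: "0 < \<mu>" and parisi: "parisi_pair \<nu> L d t \<beta> \<mu> q \<zeta>"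
begin

private abbreviation "G \<equiv> correlation_moment \<nu>"
private abbreviation "\<delta> \<equiv> delta_fun q \<zeta>"
private abbreviation "k \<equiv> \<lambda>u. deriv (K_fun L d t) (\<beta> * \<delta> u)"
private abbreviation "F \<equiv> F_fun \<nu> L d t \<beta> q \<zeta>"
private abbreviation "f \<equiv> \<lambda>s. integral {0..s} F"

private definition "maximisers =
  {s \<in> {0..q}. f_fun \<nu> L d t \<beta> q \<zeta> s = (SUP s'\<in>{0<..<q}. f_fun \<nu> L d t \<beta> q \<zeta> s')}"

lemma parisi_pairD:
  "0 < q" "prob_space \<zeta>" "sets \<zeta> = sets (restrict_space borel {0..q})"
  "space \<zeta> = {0..q}" "q \<notin> measure_support \<zeta>" "\<beta> * \<delta> 0 = resolvent_trace L d t 1 \<mu>" "measure \<zeta> maximisers = 1"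
proof -
  show sets: "sets \<zeta> = sets (restrict_space borel {0..q})"
    using parisi by (auto simp: parisi_pair_def Y_space_def)
  show "space \<zeta> = {0..q}"
    using sets_eq_imp_space_eq[OF sets] by (simp add: space_restrict_space)
qed (use parisi in \<open>auto simp: parisi_pair_def Y_space_def delta_fun_def maximisers_def\<close>)

interpretation prob_space \<zeta>
  by (rule parisi_pairD)

lemma parisi_sets: "S \<in> sets borel \<Longrightarrow> S \<subseteq> {0..q} \<Longrightarrow> S \<in> sets \<zeta>"
  using parisi_pairD(3) by (auto simp: sets_restrict_space)

lemma cdf_integrable: "(\<lambda>u. measure \<zeta> {0..u}) integrable_on {0..q}"
  by (intro integrable_on_mono_on mono_onI finite_measure_mono parisi_sets) auto

text \<open>Since \<open>q\<close> lies outside the support, some neighbourhood of \<open>q\<close>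
  carries no mass. This is what keeps \<delta> positive before \<open>q\<close>.\<close>

lemma cdf_eventually_1:
  "\<exists>c\<ge>0. c < q \<and> (\<forall>u. c \<le> u \<longrightarrow> u \<le> q \<longrightarrow> measure \<zeta> {0..u} = 1)"
proof -
  obtain U where U: "open U" "q \<in> U" "emeasure \<zeta> (U \<inter> {0..q}) = 0"
    using parisi_pairD(1,4,5) by (auto simp: measure_support_def)
  obtain e where e: "0 < e" "ball q e \<subseteq> U"
    using U by (auto simp: open_contains_ball)
  define c where "c = max 0 (q - e / 2)"
  have c: "0 \<le> c" "c < q" "q - e < c"
    using e parisi_pairD(1) by (auto simp: c_def)
  show ?thesis
  proof (intro exI[of _ c] conjI allI impI c(1,2))
    fix u assume u: "c \<le> u" "u \<le> q"
    have "{u<..q} \<subseteq> U \<inter> {0..q}"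
      using e(2) u c by (auto simp: subset_eq dist_real_def)
    then have "prob {u<..q} \<le> prob (U \<inter> {0..q})"
      using U(1) by (intro finite_measure_mono parisi_sets) auto
    also have "\<dots> = 0"
      using U(3) by (simp add: measure_def)
    finally have "prob {u<..q} = 0"
      using measure_nonneg[of \<zeta> "{u<..q}"] by linarith
    moreover have "{0..u} = space \<zeta> - {u<..q}"
      using u c parisi_pairD(4) by auto
    moreover have "{u<..q} \<in> events"
      using u c by (intro parisi_sets) auto
    ultimately show "measure \<zeta> {0..u} = 1"
      by (simp add: prob_compl)
  qed
qed

lemma delta_antimono:
  assumes "0 \<le> r" "r \<le> s" "s \<le> q"
  shows "\<delta> s \<le> \<delta> r"
  unfolding delta_fun_def using assms
  by (intro integral_subset_le integrable_on_subinterval[OF cdf_integrable]) auto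

lemma delta_pos:
  assumes "0 \<le> s" "s < q"
  shows "0 < \<delta> s"
proof -
  obtain c where c: "0 \<le> c" "c < q" "\<And>u. c \<le> u \<Longrightarrow> u \<le> q \<Longrightarrow> measure \<zeta> {0..u} = 1"
    using cdf_eventually_1 by blast
  let ?m = "max s c"
  have "\<delta> ?m = integral {?m..q} (\<lambda>u. 1)"
    unfolding delta_fun_def using c by (intro integral_cong) auto
  also have "\<dots> = q - ?m"
    using assms c by simp
  finally have "0 < \<delta> ?m"
    using assms c by simp
  also have "\<delta> ?m \<le> \<delta> s"
    using assms c by (intro delta_antimono) auto
  finally show ?thesis .
qed

text \<open>Keeps the argument of the derivative of K in the interval where that derivative is
  bounded and continuous from the lemmas above. The right end comes from the constraint at
  \<open>s = 0\<close>.\<close>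

lemma delta_range:
  assumes "0 \<le> s" "s < q"
  shows "\<beta> * \<delta> s \<in> {0<..resolvent_trace L d t 1 \<mu>}"
proof -
  have "\<beta> * \<delta> s \<le> \<beta> * \<delta> 0"
    using assms \<beta> by (intro mult_left_mono delta_antimono) auto
  then show ?thesis
    using delta_pos[OF assms] \<beta> parisi_pairD(6) by auto
qed

text \<open>The interval stops short of \<open>q\<close> because \<delta> vanishes there, and 0 lies
  outside the range of \<open>R\<^sub>1\<close>.\<close>

lemma continuous_on_kernel:
  assumes "b < q"
  shows "continuous_on {0..b} k"
proof (rule continuous_on_compose2[OF continuous_on_deriv_K_fun[OF L t \<mu>]])
  have "continuous_on {0..q} \<delta>"
    unfolding delta_fun_def[abs_def] by (intro indefinite_integral_continuous_1' cdf_integrable)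
  then show "continuous_on {0..b} (\<lambda>u. \<beta> * \<delta> u)"
    using assms by (intro continuous_on_mult continuous_on_const) (auto intro: continuous_on_subset)
qed (use assms delta_range in auto)

text \<open>The derivative is taken within \<open>{0..b}\<close> so that the end point 0 is
  included; behaviour to the right of 0 later rules out a maximiser at 0.\<close>

lemma F_has_derivative:
  assumes "0 \<le> s" "s \<le> b" "b < q"
  shows "(F has_real_derivative 4 * G 2 (2 * (q - s)) + k s) (at s within {0..b})"
proof -
  have "((\<lambda>s. 2 * G 1 (2 * (q - s))) has_real_derivative 4 * G 2 (2 * (q - s))) (at s within {0..b})"
  proof -
    have a: "(G 1 has_real_derivative - G 2 (2 * (q - s))) (at (2 * (q - s)))"
      using correlation_moment_deriv[OF \<nu>, of "2 * (q - s)" 1] assms by (simp add: numeral_2_eq_2)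
    have b: "((\<lambda>s. 2 * (q - s)) has_real_derivative - 2) (at s within {0..b})"
      by (auto intro!: derivative_eq_intros)
    show ?thesis
      using DERIV_cmult[OF DERIV_chain2[OF a b], of 2] by simp
  qed
  moreover have "((\<lambda>s. integral {0..s} k) has_real_derivative k s) (at s within {0..b})"
    using assms by (intro integral_has_real_derivative continuous_on_kernel) auto
  ultimately have "((\<lambda>s. 2 * G 1 (2 * (q - s)) + integral {0..s} k) has_real_derivative
      4 * G 2 (2 * (q - s)) + k s) (at s within {0..b})"
    by (rule DERIV_add)
  then show ?thesis
    by (rule has_field_derivative_transform_within[where d = 1])
      (use assms in \<open>auto simp: F_fun_def deriv_B_fun[OF \<nu>]\<close>)
qed

lemma continuous_on_F: "b < q \<Longrightarrow> continuous_on {0..b} F"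
  using F_has_derivative by (intro DERIV_continuous_on) auto

lemma f_has_derivative:
  assumes "0 \<le> s" "s \<le> b" "b < q"
  shows "(f has_real_derivative F s) (at s within {0..b})"
  using assms by (intro integral_has_real_derivative continuous_on_F) auto

lemma DERIV_F:
  assumes "0 < s" "s < q"
  shows "(F has_real_derivative 4 * G 2 (2 * (q - s)) + k s) (at s)"
  using F_has_derivative[of s "(s + q) / 2"] assms by (simp add: at_within_Icc_at)

lemma DERIV_f:
  assumes "0 < s" "s < q"
  shows "(f has_real_derivative F s) (at s)"
  using f_has_derivative[of s "(s + q) / 2"] assms by (simp add: at_within_Icc_at)

section \<open>First and second order conditions at maximisers\<close>

lemma maximiser_less: "s \<in> maximisers \<Longrightarrow> s < q"
  and maximiser_le: "s \<in> maximisers \<Longrightarrow> 0 < r \<Longrightarrow> r < q \<Longrightarrow> f r \<le> f s"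
proof -
  assume s: "s \<in> maximisers"
  have le: "f_fun \<nu> L d t \<beta> q \<zeta> r \<le> f_fun \<nu> L d t \<beta> q \<zeta> s" if "0 < r" "r < q" for r
    using s that by (auto simp: maximisers_def intro!: SUP_upper)
  \<comment> \<open>\<open>f_fun\<close> is minus infinity at \<open>q\<close> but finite at
    \<open>q / 2\<close>.\<close>
  have "s \<noteq> q"
    using le[of "q / 2"] parisi_pairD(1) by (auto simp: f_fun_def)
  then show less: "s < q"
    using s by (auto simp: maximisers_def)
  show "f r \<le> f s" if "0 < r" "r < q"
    using le[OF that] that less by (auto simp: f_fun_def)
qed

text \<open>At 0 the integral term of F is empty and the remaining term, minus twice the derivative
  of B at \<open>2 * q\<close>, is positive. So f increases to the right of 0.\<close>

lemma maximiser_pos: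
  assumes s: "s \<in> maximisers"
  shows "0 < s"
proof (rule ccontr)
  assume "\<not> 0 < s"
  then have "s = 0"
    using s by (auto simp: maximisers_def)
  have "0 < F 0"
    using deriv_B_fun[OF \<nu>, of "2 * q"] correlation_moment_pos[OF \<nu>, of "2 * q" 1] parisi_pairD(1)
    by (simp add: F_fun_def)
  moreover have "(f has_real_derivative F 0) (at 0 within {0..q / 2})"
    using parisi_pairD(1) by (intro f_has_derivative) auto
  ultimately obtain e where e: "0 < e" "\<And>h. 0 < h \<Longrightarrow> h \<in> {0..q / 2} \<Longrightarrow> h < e \<Longrightarrow> f 0 < f h"
    using has_real_derivative_pos_inc_right[of f "F 0" 0 "{0..q / 2}"] by force
  let ?h = "min (e / 2) (q / 2)"
  have "f 0 < f ?h"
    using e(1) parisi_pairD(1) by (intro e(2)) auto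
  moreover have "f ?h \<le> f 0"
    using maximiser_le[OF s, of ?h] e(1) parisi_pairD(1) \<open>s = 0\<close> by auto
  ultimately show False
    by simp
qed

lemma maximiser_F_eq_0:
  assumes s: "s \<in> maximisers"
  shows "F s = 0"
proof (rule DERIV_local_max)
  show "(f has_real_derivative F s) (at s)"
    using DERIV_f maximiser_pos[OF s] maximiser_less[OF s] .
  show "0 < min s (q - s)"
    using maximiser_pos[OF s] maximiser_less[OF s] by simp
  show "\<forall>r. \<bar>s - r\<bar> < min s (q - s) \<longrightarrow> f r \<le> f s"
    using maximiser_le[OF s] by (auto simp: abs_less_iff)
qed

text \<open>If the derivative of F were positive at \<open>s\<close>, then \<open>F s = 0\<close>
  would force F to be positive just to the right of \<open>s\<close>, and f would exceed its maximum
  there.\<close>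

lemma maximiser_second_order:
  assumes s: "s \<in> maximisers"
  shows "4 * G 2 (2 * (q - s)) + k s \<le> 0"
proof (rule ccontr)
  assume "\<not> ?thesis"
  moreover note sq = maximiser_pos[OF s] maximiser_less[OF s]
  ultimately obtain e where e: "0 < e" "\<And>h. 0 < h \<Longrightarrow> h < e \<Longrightarrow> F s < F (s + h)"
    using DERIV_pos_inc_right[OF DERIV_F[OF sq]] by force
  obtain m where m: "0 < m" "m < e" "m < q - s"
    using field_lbound_gt_zero[of e "q - s"] e(1) sq by auto
  define r where "r = s + m"
  have r: "s < r" "r < q" "r < s + e"
    using m by (auto simp: r_def)
  have "f s < f r"
  proof (rule DERIV_pos_imp_increasing_open[OF r(1)])
    fix x assume x: "s < x" "x < r"
    have "0 < F x"
      using e(2)[of "x - s"] x r maximiser_F_eq_0[OF s] by simp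
    then show "\<exists>y. (f has_real_derivative y) (at x) \<and> 0 < y"
      using DERIV_f[of x] x r sq by auto
  next
    show "continuous_on {s..r} f"
    proof (rule continuous_at_imp_continuous_on, rule ballI)
      fix x assume "x \<in> {s..r}"
      then show "isCont f x"
        using sq r by (intro DERIV_isCont[OF DERIV_f]) auto
    qed
  qed
  then show False
    using maximiser_le[OF s, of r] r sq by simp
qed

section \<open>Consequences for the Parisi measure\<close>

lemma replica_symmetric_if_larkin_mass_le:
  assumes "larkin_mass \<nu> L d t \<le> \<mu>"
  shows "replica_symmetric \<zeta>"
proof -
  have R2: "0 < resolvent_trace L d t 2 \<mu>"
    by (rule resolvent_trace_pos[OF L t \<mu>])
  have "4 * G 2 0 * resolvent_trace L d t 2 \<mu> \<le> 1"
    using assms larkin_mass_iff[OF L t \<nu> \<mu>] by simp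
  then have G0: "4 * G 2 0 \<le> inverse (resolvent_trace L d t 2 \<mu>)"
    using R2 by (simp add: field_simps)
  have neg: "4 * G 2 (2 * (q - s)) + k s < 0" if "0 < s" "s < q" for s
  proof -
    have "G 2 (2 * (q - s)) < G 2 0"
      using that by (intro correlation_moment_strict_antimono[OF \<nu>]) auto
    moreover have "k s \<le> - inverse (resolvent_trace L d t 2 \<mu>)"
      using delta_range[of s] that by (intro deriv_K_fun_le[OF L t \<mu>]) auto
    ultimately show ?thesis
      using G0 by linarith
  qed
  have less: "F r < F s" if "0 < s" "s < r" "r < q" for r s
  proof (rule DERIV_neg_imp_decreasing[OF that(2)])
    fix x assume "s \<le> x" "x \<le> r"
    then have "0 < x" "x < q"
      using that by auto
    then show "\<exists>y. (F has_real_derivative y) (at x) \<and> y < 0"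
      using DERIV_F neg by blast
  qed
  have uniq: "r = s" if "r \<in> maximisers" "s \<in> maximisers" for r s
    using less[of r s] less[of s r] maximiser_F_eq_0[OF that(1)] maximiser_F_eq_0[OF that(2)]
      maximiser_pos[OF that(1)] maximiser_pos[OF that(2)]
      maximiser_less[OF that(1)] maximiser_less[OF that(2)]
    by (cases r s rule: linorder_cases) auto
  \<comment> \<open>Mass one excludes the empty set; with uniqueness, all the mass sits at one
    point.\<close>
  have "maximisers \<noteq> {}"
    using parisi_pairD(7) by auto
  then obtain s where s: "maximisers = {s}"
    using uniq by blast
  then have "s \<in> {0..q}"
    by (auto simp: maximisers_def)
  moreover have "\<zeta> = return \<zeta> s"
    using parisi_pairD(7) \<open>s \<in> {0..q}\<close> s by (intro eq_return_if_prob_eq_1 parisi_sets) auto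
  ultimately show ?thesis
    using parisi_pairD(4) by (auto simp: replica_symmetric_def)
qed

lemma not_replica_symmetry_breaking_imp:
  assumes "\<not> replica_symmetry_breaking \<zeta>"
  shows "4 * G 2 (2 * resolvent_trace L d t 1 \<mu> / \<beta>) * resolvent_trace L d t 2 \<mu> \<le> 1"
proof -
  have "U \<inter> space \<zeta> \<in> events" if "open U" for U
    unfolding parisi_pairD(4) using that by (intro parisi_sets) auto
  then obtain x where x: "prob {x} = 1"
    using atom_if_not_replica_symmetry_breaking[OF parisi_pairD(2) _ assms] by blast
  \<comment> \<open>\<open>measure\<close> is 0 on non-measurable sets, so value 1 already implies
    measurability.\<close>
  have xs: "{x} \<in> events" and ms: "maximisers \<in> events"
    using x parisi_pairD(7) measure_notin_sets by force+
  have max: "x \<in> maximisers"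
  proof (rule ccontr)
    assume "x \<notin> maximisers"
    then have "prob ({x} \<union> maximisers) = 2"
      using xs ms x parisi_pairD(7) by (subst finite_measure_Union) auto
    then show False
      using prob_le_1[of "{x} \<union> maximisers"] by simp
  qed
  note xq = maximiser_pos[OF max] maximiser_less[OF max]
  have one: "measure \<zeta> {0..u} = 1" if "x \<le> u" "u \<le> q" for u
  proof (rule antisym[OF prob_le_1])
    have "prob {x} \<le> prob {0..u}"
      using that xq by (intro finite_measure_mono parisi_sets) auto
    then show "1 \<le> prob {0..u}"
      using x by simp
  qed
  have zero: "measure \<zeta> {0..u} = 0" if "u < x" for u
  proof -
    have "prob ({x} \<union> {0..u}) = 1 + prob {0..u}"
      using that xs x xq by (subst finite_measure_Union) (auto intro!: parisi_sets)
    then show ?thesis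
      using prob_le_1[of "{x} \<union> {0..u}"] measure_nonneg[of \<zeta> "{0..u}"] by linarith
  qed
  have \<delta>x: "\<delta> x = q - x"
  proof -
    have "\<delta> x = integral {x..q} (\<lambda>_. 1)"
      unfolding delta_fun_def using one by (intro integral_cong) auto
    then show ?thesis
      using xq by simp
  qed
  \<comment> \<open>The distribution function vanishes before \<open>x\<close> and jumps to 1 at
    \<open>x\<close>; the single point \<open>x\<close> is negligible.\<close>
  have "integral {0..x} (\<lambda>u. measure \<zeta> {0..u}) = integral {0..x} (\<lambda>_. 0)"
    by (rule integral_spike[of "{x}"]) (auto simp: zero)
  then have "\<delta> 0 = \<delta> x"
    using Henstock_Kurzweil_Integration.integral_combine[of 0 x q, OF _ _ cdf_integrable] xq
    by (simp add: delta_fun_def)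
  then have \<beta>x: "\<beta> * \<delta> x = resolvent_trace L d t 1 \<mu>" "\<beta> * (q - x) = resolvent_trace L d t 1 \<mu>"
    using parisi_pairD(6) \<delta>x by auto
  have R2: "0 < resolvent_trace L d t 2 \<mu>"
    by (rule resolvent_trace_pos[OF L t \<mu>])
  have "2 * (q - x) = 2 * resolvent_trace L d t 1 \<mu> / \<beta>"
    using \<beta>x(2) \<beta> by (simp add: field_simps)
  then have "4 * G 2 (2 * resolvent_trace L d t 1 \<mu> / \<beta>) - inverse (resolvent_trace L d t 2 \<mu>) \<le> 0"
    using maximiser_second_order[OF max] deriv_K_fun_resolvent_trace[OF L t \<mu>] \<beta>x(1) by simp
  then show ?thesis
    using R2 by (simp add: field_simps)
qed

end

section \<open>The two regimes of the mass\<close>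

theorem theorem1p10:
  fixes \<nu> :: "real measure" and L d :: nat and t :: real
  assumes "1 \<le> L" and "0 < t" and "correlation_measure \<nu>"
  shows "(\<forall>\<mu>>0. \<mu> < larkin_mass \<nu> L d t \<longrightarrow>
            (\<exists>\<beta>\<^sub>0>0. \<forall>\<beta>\<ge>\<beta>\<^sub>0. \<forall>q \<zeta>. parisi_pair \<nu> L d t \<beta> \<mu> q \<zeta> \<longrightarrow> replica_symmetry_breaking \<zeta>)) \<and>
         (\<forall>\<mu>>0. larkin_mass \<nu> L d t \<le> \<mu> \<longrightarrow>
            (\<forall>\<beta>>0. \<forall>q \<zeta>. parisi_pair \<nu> L d t \<beta> \<mu> q \<zeta> \<longrightarrow> replica_symmetric \<zeta>))"
proof (intro conjI allI impI)
  fix \<mu> :: real assume \<mu>: "0 < \<mu>" "\<mu> < larkin_mass \<nu> L d t"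
  let ?G = "correlation_moment \<nu> 2" and ?R = "resolvent_trace L d t"
  have R: "0 < ?R 1 \<mu>"
    using assms \<mu> by (intro resolvent_trace_pos)
  have "1 < 4 * ?G 0 * ?R 2 \<mu>"
    using larkin_mass_iff[OF assms \<mu>(1), of d] \<mu>(2) by linarith
  \<comment> \<open>By continuity the strict inequality at 0 persists for small positive
    arguments.\<close>
  moreover have "isCont (\<lambda>x. 4 * ?G x * ?R 2 \<mu>) 0"
    using correlation_moment_deriv[OF assms(3), of 0 2] by (intro continuous_intros DERIV_isCont) auto
  ultimately have "\<forall>\<^sub>F x in at 0. 1 < 4 * ?G x * ?R 2 \<mu>"
    unfolding isCont_def by (intro order_tendstoD)
  then obtain e where e: "0 < e" "\<And>x. 0 < x \<Longrightarrow> x < e \<Longrightarrow> 1 < 4 * ?G x * ?R 2 \<mu>"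
    unfolding eventually_at by (auto simp: dist_real_def)
  show "\<exists>\<beta>\<^sub>0>0. \<forall>\<beta>\<ge>\<beta>\<^sub>0. \<forall>q \<zeta>. parisi_pair \<nu> L d t \<beta> \<mu> q \<zeta> \<longrightarrow> replica_symmetry_breaking \<zeta>"
  \<comment> \<open>The factor 4 in place of 2 gives
    \<open>2 * ?R 1 \<mu> / \<beta> \<le> e / 2\<close>, so the bound by \<open>e\<close> is strict
    even at the threshold itself.\<close>
  proof (intro exI[of _ "4 * ?R 1 \<mu> / e"] conjI allI impI)
    show "0 < 4 * ?R 1 \<mu> / e"
      using R e(1) by simp
    fix \<beta> q :: real and \<zeta> assume \<beta>: "4 * ?R 1 \<mu> / e \<le> \<beta>" and P: "parisi_pair \<nu> L d t \<beta> \<mu> q \<zeta>"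
    have "0 < 4 * ?R 1 \<mu> / e"
      using R e(1) by simp
    then have \<beta>0: "0 < \<beta>"
      using \<beta> by linarith
    have "2 * ?R 1 \<mu> / \<beta> < e"
    proof -
      have "4 * ?R 1 \<mu> \<le> \<beta> * e"
        using \<beta> e(1) by (simp add: field_simps)
      then have "2 * ?R 1 \<mu> < e * \<beta>"
        using R by (simp add: mult.commute)
      then show ?thesis
        using \<beta>0 by (simp add: field_simps)
    qed
    then have "1 < 4 * ?G (2 * ?R 1 \<mu> / \<beta>) * ?R 2 \<mu>"
      using R \<beta>0 by (intro e(2)) auto
    then show "replica_symmetry_breaking \<zeta>"
      using not_replica_symmetry_breaking_imp[OF assms \<beta>0 \<mu>(1) P] by linarith
  qed
next
  fix \<mu> \<beta> q :: real and \<zeta>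
  assume "0 < \<mu>" "larkin_mass \<nu> L d t \<le> \<mu>" "0 < \<beta>" "parisi_pair \<nu> L d t \<beta> \<mu> q \<zeta>"
  then show "replica_symmetric \<zeta>"
    using replica_symmetric_if_larkin_mass_le[OF assms] by blast
qed

end
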